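(* Let $(m,n,k)\in\mathbb{Z}^3$ be such that $k^2-4mn>0$ is not a perfect square. The period $\Gamma(m,n,k)$ is even and neither palindromic nor bipalindromic if and only if the class $C(m,n,k)$ is asymmetric.
   Context: The triple $\mathbf f=(m,n,k)\in\mathbb{Z}^3$ denotes the binary quadratic form $f(x,y)=mx^2+ny^2+kxy$. The class $C(\mathbf f)=C(m,n,k)$ is the orbit of $\mathbf f$ under the action of $\mathrm{SL}(2,\mathbb{Z})$ by linear changes of the variables $(x,y)$. For $\mathbf f=(m,n,k)$ define the conjugate $\overline{\mathbf f}=(m,n,-k)$, the adjoint $\mathbf f^*=(-n,-m,k)$ and the antipodal $\overline{\mathbf f}^*=(-n,-m,-k)$. If a class contains one form together with its image under one of these involutions, the whole class is invariant under that involution. A class is called asymmetric if it is invariant under none of the three involutions (conjugation, adjoint, antipodal). For $k^2-4mn>0$ not a perfect square, put $\xi^{+}(\mathbf f)=\frac{-k+\sqrt{k^2-4mn}}{2m}$; its (regular) continued fraction is eventually periodic (the continued fraction of a negative number $\xi$ is written $-[\alpha_0,\alpha_1,\dots]$, where $[\alpha_0,\alpha_1,\dots]$ is that of $|\xi|$). $\Gamma(m,n,k)$ denotes its period, i.e. its minimal repeating block of positive integers, considered up to cyclic permutation. A period is even (odd) if its length is even (odd). A period is palindromic if some cyclic permutation of it is equal to the same sequence written backwards. A period is bipalindromic if some cyclic permutation of it can be subdivided into two consecutive (nonempty) sequences, each of odd length and each a palindrome. *)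

theory Defs
  imports Complex_Main "HOL-Computational_Algebra.Nth_Powers"
begin

section \<open>Binary quadratic forms and their symmetries\<close>

text \<open>The triple \<open>(m, n, k)\<close> denotes the form \<open>m x\<^sup>2 + n y\<^sup>2 + k x y\<close>; the coefficient of
  the mixed term comes last.\<close>

type_synonym form = "int \<times> int \<times> int"

fun form_eval :: "form \<Rightarrow> int \<Rightarrow> int \<Rightarrow> int" where
  "form_eval (m, n, k) x y = m * x\<^sup>2 + n * y\<^sup>2 + k * x * y"

definition form_class :: "form \<Rightarrow> form set" where
  "form_class f = {g. \<exists>a b c d :: int. a * d - b * c = 1 \<and>
     (\<forall>x y. form_eval g x y = form_eval f (a * x + b * y) (c * x + d * y))}"

fun conjugate_form :: "form \<Rightarrow> form" where
  "conjugate_form (m, n, k) = (m, n, - k)"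

fun adjoint_form :: "form \<Rightarrow> form" where
  "adjoint_form (m, n, k) = (- n, - m, k)"

fun antipodal_form :: "form \<Rightarrow> form" where
  "antipodal_form (m, n, k) = (- n, - m, - k)"

definition invariant_under :: "(form \<Rightarrow> form) \<Rightarrow> form set \<Rightarrow> bool" where
  "invariant_under \<sigma> C \<longleftrightarrow> \<sigma> ` C = C"

definition asymmetric :: "form set \<Rightarrow> bool" where
  "asymmetric C \<longleftrightarrow> \<not> invariant_under conjugate_form C \<and>
     \<not> invariant_under adjoint_form C \<and> \<not> invariant_under antipodal_form C"

section \<open>Continued fractions and periods\<close>

fun xi_plus :: "form \<Rightarrow> real" where
  "xi_plus (m, n, k) =
     (- real_of_int k + sqrt (real_of_int (k\<^sup>2 - 4 * m * n))) / (2 * real_of_int m)"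

text \<open>Complete quotients and partial quotients of the regular continued fraction. They are only
  meaningful as an infinite expansion for irrational arguments.\<close>

fun complete_quotient :: "real \<Rightarrow> nat \<Rightarrow> real" where
  "complete_quotient x 0 = x"
| "complete_quotient x (Suc i) = 1 / frac (complete_quotient x i)"

definition partial_quotient :: "real \<Rightarrow> nat \<Rightarrow> int" where
  "partial_quotient x i = \<lfloor>complete_quotient x i\<rfloor>"

text \<open>The continued fraction of a negative number \<open>\<xi>\<close> is by convention
  \<open>-[\<alpha>\<^sub>0, \<alpha>\<^sub>1, \<dots>]\<close>, where \<open>[\<alpha>\<^sub>0, \<alpha>\<^sub>1, \<dots>]\<close> is that of \<open>\<bar>\<xi>\<bar>\<close>.\<close>

definition cf_elements :: "real \<Rightarrow> nat \<Rightarrow> int" where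
  "cf_elements \<xi> = partial_quotient \<bar>\<xi>\<bar>"

definition repeating_block :: "(nat \<Rightarrow> 'a) \<Rightarrow> 'a list \<Rightarrow> bool" where
  "repeating_block s w \<longleftrightarrow> w \<noteq> [] \<and> (\<exists>N. \<forall>i. s (N + i) = w ! (i mod length w))"

definition minimal_repeating_block :: "(nat \<Rightarrow> 'a) \<Rightarrow> 'a list \<Rightarrow> bool" where
  "minimal_repeating_block s w \<longleftrightarrow>
     repeating_block s w \<and> (\<forall>v. repeating_block s v \<longrightarrow> length w \<le> length v)"

text \<open>A period is considered up to cyclic permutation, so it is represented by the set of all
  minimal repeating blocks. For an eventually periodic sequence this set consists precisely of all
  cyclic permutations of one block, because the starting index \<open>N\<close> in \<open>repeating_block\<close> can
  be shifted. Hence "some cyclic permutation of the period" below is "some element of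
  the set".\<close>

definition Gamma :: "form \<Rightarrow> int list set" where
  "Gamma f = {w. minimal_repeating_block (cf_elements (xi_plus f)) w}"

definition even_period :: "'a list set \<Rightarrow> bool" where
  "even_period P \<longleftrightarrow> (\<exists>w\<in>P. even (length w))"

definition palindromic_period :: "'a list set \<Rightarrow> bool" where
  "palindromic_period P \<longleftrightarrow> (\<exists>w\<in>P. rev w = w)"

definition bipalindromic_period :: "'a list set \<Rightarrow> bool" where
  "bipalindromic_period P \<longleftrightarrow> (\<exists>u v. u @ v \<in> P \<and>
     odd (length u) \<and> rev u = u \<and> odd (length v) \<and> rev v = v)"

end

theory Submission
  imports Defs "HOL-Computational_Algebra.Polynomial"
begin

text \<open>
  The class of a form \<open>f\<close> whose discriminant is positive and not a square is determined by the
  discriminant and the \<open>SL(2,\<int>)\<close>-orbit of the root \<open>\<xi>\<close> of \<open>f\<close>. The conjugate, adjoint and antipodal form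
  have the roots \<open>-\<xi>'\<close>, \<open>-1/\<xi>'\<close> and \<open>1/\<xi>\<close>, where \<open>\<xi>'\<close> is the second root of \<open>f\<close>. Since inversion has
  determinant \<open>-1\<close>, the three symmetries of the class say the following
  (\<open>symmetric_class_iff_moebius\<close>): \<open>-1/\<xi>'\<close> arises from \<open>\<xi>\<close> by a unimodular transformation of determinant
  \<open>-1\<close> (conjugation) or \<open>1\<close> (adjoint), or \<open>\<xi>\<close> is fixed by one of determinant \<open>-1\<close> (antipodal).

  By Serret's theorem (\<open>serret\<close>), two irrational numbers are related by a transformation of determinant
  \<open>\<plusminus>1\<close> iff they have a common complete quotient, and the determinant is \<open>-1\<close> to the power
  of the sum of the two indices. By Lagrange's argument (\<open>lagrange\<close>), the complete quotients of \<open>\<xi>\<close> are roots of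
  forms with the same discriminant, which from some index on are reduced (first root above \<open>1\<close>, second
  root between \<open>-1\<close> and \<open>0\<close>); there are only finitely many of these, so the expansion is eventually
  periodic. Each step transforms \<open>\<xi>\<close> and \<open>-1/\<xi>'\<close> with the same determinant, so \<open>\<xi>\<close> may be replaced by the
  root of a reduced form with a purely periodic expansion. Extend its partial quotients to a
  periodic sequence \<open>A\<close> on the integers, with least period \<open>r\<close>. By Galois' observation, \<open>-1/\<xi>'\<close>
  reads the sequence backwards: its partial quotients are \<open>A (-1), A (-2), \<dots>\<close>.

  Comparing tails (\<open>surd_period\<close>), the class is antipodally invariant iff \<open>r\<close> is odd, and it is
  invariant under the adjoint (conjugation) iff \<open>A\<close> has a symmetry \<open>i \<mapsto> s - i\<close> with \<open>s\<close> odd (even). When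
  \<open>r\<close> is even, the parity of \<open>s\<close> is what separates the two shapes of a period: for \<open>s\<close> odd the centre of
  the reflection lies between two entries and cutting there exhibits a palindrome of even length, while for
  \<open>s\<close> even the centres are the entries \<open>s / 2\<close> and \<open>s / 2 + r / 2\<close> and the period is bipalindromic.
\<close>

section \<open>Complete quotients of irrational numbers\<close>

lemma complete_quotient_add:
  "complete_quotient x (i + j) = complete_quotient (complete_quotient x i) j"
  by (induction j) auto

lemma partial_quotient_add:
  "partial_quotient x (i + j) = partial_quotient (complete_quotient x i) j"
  by (simp add: partial_quotient_def complete_quotient_add)

lemma irrational_imp_not_int: "x \<notin> \<rat> \<Longrightarrow> x \<notin> \<int>"
  using Ints_subset_Rats by blast

lemma irrational_frac_pos: "x \<notin> \<rat> \<Longrightarrow> 0 < frac x" for x :: real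
  by (simp add: irrational_imp_not_int)

lemma irrational_add_int: "x \<notin> \<rat> \<Longrightarrow> x + of_int n \<notin> \<rat>" for x :: real
  by (metis Rats_add_iff Rats_of_int)

lemma irrational_uminus: "x \<notin> \<rat> \<Longrightarrow> - x \<notin> \<rat>" for x :: real
  using Rats_minus_iff by blast

lemma irrational_inverse: "x \<notin> \<rat> \<Longrightarrow> 1 / x \<notin> \<rat>" for x :: real
  by (metis Rats_inverse inverse_eq_divide inverse_inverse_eq)

lemma irrational_frac: "x \<notin> \<rat> \<Longrightarrow> frac x \<notin> \<rat>" for x :: real
  unfolding frac_def using irrational_add_int[of x "- \<lfloor>x\<rfloor>"] by simp

lemma complete_quotient_irrational: "x \<notin> \<rat> \<Longrightarrow> complete_quotient x i \<notin> \<rat>"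
  by (induction i) (simp_all add: irrational_inverse irrational_frac)

lemma complete_quotient_gt_1:
  assumes "x \<notin> \<rat>" and "0 < i"
  shows "1 < complete_quotient x i"
proof -
  obtain j where "i = Suc j" using \<open>0 < i\<close> gr0_implies_Suc by blast
  then show ?thesis
    using irrational_frac_pos[OF complete_quotient_irrational[OF \<open>x \<notin> \<rat>\<close>, of j]]
      frac_lt_1[of "complete_quotient x j"] by simp
qed

text \<open>With equal integer parts, \<open>\<bar>x - y\<bar>\<close> is divided by \<open>frac x * frac y\<close> at each step. One factor may be
  close to \<open>1\<close>, but two consecutive fractional parts of the same number have product at most \<open>1 / 2\<close>,
  because \<open>frac u = 1 / v\<close> with \<open>v \<ge> 1 + frac v \<ge> 2 * frac v\<close>. Hence two steps gain a factor of \<open>4\<close>.\<close>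

lemma partial_quotients_expand:
  assumes "x \<notin> \<rat>" and "y \<notin> \<rat>"
    and same: "\<And>i. i < 2 \<Longrightarrow> partial_quotient x i = partial_quotient y i"
  shows "4 * \<bar>x - y\<bar> \<le> \<bar>complete_quotient x 2 - complete_quotient y 2\<bar>"
proof -
  have two: "frac u * frac (1 / frac u) \<le> 1 / 2 \<and> 0 < frac u * frac (1 / frac u)"
    if "u \<notin> \<rat>" for u :: real
  proof -
    define v where "v = 1 / frac u"
    have fu: "0 < frac u" "frac u < 1" using irrational_frac_pos[OF that] frac_lt_1 by auto
    have v: "1 < v" using fu by (simp add: v_def)
    have "v \<notin> \<rat>" using that by (simp add: v_def irrational_inverse irrational_frac)
    then have fv: "0 < frac v" "frac v < 1" using irrational_frac_pos frac_lt_1 by auto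
    have "1 \<le> \<lfloor>v\<rfloor>" using v by simp
    then have "1 \<le> real_of_int \<lfloor>v\<rfloor>" by simp
    then have "1 + frac v \<le> v" unfolding frac_def by linarith
    then have "2 * frac v \<le> v" using fv by linarith
    moreover have "frac u = 1 / v" using fu by (simp add: v_def)
    ultimately have "frac u * frac v \<le> 1 / 2" using v by (simp add: pos_divide_le_eq)
    moreover have "0 < frac u * frac v" using fu fv by simp
    ultimately show ?thesis by (simp add: v_def)
  qed
  have diff: "\<bar>1 / frac u - 1 / frac v\<bar> = \<bar>u - v\<bar> / (frac u * frac v)"
    if "u \<notin> \<rat>" "v \<notin> \<rat>" "\<lfloor>u\<rfloor> = \<lfloor>v\<rfloor>" for u v :: real
  proof -
    have p: "0 < frac u" "0 < frac v" using that irrational_frac_pos by auto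
    have "1 / frac u - 1 / frac v = (frac v - frac u) / (frac u * frac v)"
      using p by (simp add: field_simps)
    also have "frac v - frac u = v - u" using that by (simp add: frac_def)
    finally show ?thesis using p by (simp add: abs_divide abs_mult abs_minus_commute)
  qed
  define x1 y1 where "x1 = 1 / frac x" and "y1 = 1 / frac y"
  have irr: "x1 \<notin> \<rat>" "y1 \<notin> \<rat>"
    using assms by (simp_all add: x1_def y1_def irrational_inverse irrational_frac)
  have fl: "\<lfloor>x\<rfloor> = \<lfloor>y\<rfloor>" "\<lfloor>x1\<rfloor> = \<lfloor>y1\<rfloor>"
    using same[of 0] same[of 1] by (auto simp: partial_quotient_def x1_def y1_def)
  have "\<bar>complete_quotient x 2 - complete_quotient y 2\<bar> = \<bar>1 / frac x1 - 1 / frac y1\<bar>"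
    by (simp add: numeral_2_eq_2 x1_def y1_def)
  also have "\<dots> = \<bar>x1 - y1\<bar> / (frac x1 * frac y1)" by (rule diff[OF irr fl(2)])
  also have "\<bar>x1 - y1\<bar> = \<bar>x - y\<bar> / (frac x * frac y)"
    unfolding x1_def y1_def by (rule diff[OF assms(1,2) fl(1)])
  finally have eq: "\<bar>complete_quotient x 2 - complete_quotient y 2\<bar>
      = \<bar>x - y\<bar> / ((frac x * frac x1) * (frac y * frac y1))" by (simp add: mult_ac)
  have "(frac x * frac x1) * (frac y * frac y1) \<le> 1 / 2 * (1 / 2)"
    using two[OF assms(1)] two[OF assms(2)] by (intro mult_mono) (auto simp: x1_def y1_def)
  moreover have "0 < (frac x * frac x1) * (frac y * frac y1)"
    using two[OF assms(1)] two[OF assms(2)] by (intro mult_pos_pos[of "frac x * frac x1"]) (auto simp: x1_def y1_def)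
  ultimately have "\<bar>x - y\<bar> * (4 * ((frac x * frac x1) * (frac y * frac y1))) \<le> \<bar>x - y\<bar> * 1"
    by (intro mult_left_mono) auto
  then show ?thesis
    unfolding eq using \<open>0 < (frac x * frac x1) * (frac y * frac y1)\<close>
    by (simp add: pos_le_divide_eq mult_ac)
qed

text \<open>Otherwise the distance of corresponding complete quotients would grow without bound, while numbers
  with the same integer part differ by less than \<open>1\<close>.\<close>

lemma partial_quotients_inj:
  assumes "x \<notin> \<rat>" and "y \<notin> \<rat>" and same: "\<And>i. partial_quotient x i = partial_quotient y i"
  shows "x = y"
proof (rule ccontr)
  assume "x \<noteq> y"
  have grow: "4 ^ t * \<bar>x - y\<bar> \<le> \<bar>complete_quotient x (2 * t) - complete_quotient y (2 * t)\<bar>" for t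
  proof (induction t)
    case (Suc t)
    have "4 * \<bar>complete_quotient x (2 * t) - complete_quotient y (2 * t)\<bar>
        \<le> \<bar>complete_quotient (complete_quotient x (2 * t)) 2
            - complete_quotient (complete_quotient y (2 * t)) 2\<bar>"
      by (rule partial_quotients_expand)
        (auto simp: assms complete_quotient_irrational simp flip: partial_quotient_add)
    with Suc show ?case by (simp flip: complete_quotient_add)
  qed simp
  obtain t where "1 / \<bar>x - y\<bar> < 4 ^ t"
    using real_arch_pow[of 4 "1 / \<bar>x - y\<bar>"] by auto
  then have "1 < 4 ^ t * \<bar>x - y\<bar>" using \<open>x \<noteq> y\<close> by (simp add: field_simps)
  also note grow[of t]
  also have "\<bar>complete_quotient x (2 * t) - complete_quotient y (2 * t)\<bar> < 1"
  proof -
    have "\<lfloor>complete_quotient x (2 * t)\<rfloor> = \<lfloor>complete_quotient y (2 * t)\<rfloor>"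
      using same[of "2 * t"] by (simp add: partial_quotient_def)
    then show ?thesis by linarith
  qed
  finally show False .
qed

section \<open>Equal tails and unimodular transformations\<close>

text \<open>The sign \<open>e\<close> is the determinant of the unimodular transformation that takes \<open>x\<close> to \<open>y\<close> through the common
  complete quotient, as each continued fraction step has determinant \<open>-1\<close>.\<close>

definition tails_meet :: "int \<Rightarrow> real \<Rightarrow> real \<Rightarrow> bool" where
  "tails_meet e x y \<longleftrightarrow>
     (\<exists>p q. complete_quotient x p = complete_quotient y q \<and> (-1) ^ (p + q) = e)"

lemma tails_meet_I:
  "complete_quotient x p = complete_quotient y q \<Longrightarrow> (-1) ^ (p + q) = e \<Longrightarrow> tails_meet e x y"
  unfolding tails_meet_def by blast

lemma tails_meet_trans:
  assumes "tails_meet e x y" and "tails_meet e' y z"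
  shows "tails_meet (e * e') x z"
proof -
  obtain p q where pq: "complete_quotient x p = complete_quotient y q" "(-1) ^ (p + q) = e"
    using assms(1) unfolding tails_meet_def by blast
  obtain r s where rs: "complete_quotient y r = complete_quotient z s" "(-1) ^ (r + s) = e'"
    using assms(2) unfolding tails_meet_def by blast
  have "complete_quotient x (p + r) = complete_quotient y (r + q)"
    using pq by (simp add: complete_quotient_add add.commute[of r])
  also have "\<dots> = complete_quotient z (s + q)"
    using rs by (simp add: complete_quotient_add)
  finally have "complete_quotient x (p + r) = complete_quotient z (s + q)" .
  moreover have "(-1) ^ ((p + r) + (s + q)) = e * e'"
    unfolding pq(2)[symmetric] rs(2)[symmetric] by (simp add: power_add)
  ultimately show ?thesis by (rule tails_meet_I)
qed

lemma tails_meet_sym: "tails_meet e x y \<Longrightarrow> tails_meet e y x"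
  unfolding tails_meet_def by (metis add.commute)

lemma tails_meet_add_int: "tails_meet 1 x (x + of_int n)"
  by (rule tails_meet_I[of _ 1 _ 1]) (simp_all add: frac_def)

lemma tails_meet_inverse_gt_1: "1 < x \<Longrightarrow> tails_meet (-1) x (1 / x)"
  by (rule tails_meet_I[of _ 0 _ 1]) (simp_all add: frac_eq[THEN iffD2])

text \<open>In terms of expansions, \<open>-[a, b, c, \<dots>]\<close> is \<open>[-a-1, 1, b-1, c, \<dots>]\<close> for \<open>b > 1\<close> and
  \<open>[-a-1, c+1, d, \<dots>]\<close> for \<open>b = 1\<close>; in both cases the tails meet at indices of different parity.\<close>

lemma tails_meet_uminus:
  assumes "x \<notin> \<rat>"
  shows "tails_meet (-1) x (- x)"
proof -
  define x1 where "x1 = 1 / frac x"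
  have f: "0 < frac x" "frac x < 1" using irrational_frac_pos[OF assms] frac_lt_1 by auto
  have irr: "x1 \<notin> \<rat>" using assms by (simp add: x1_def irrational_inverse irrational_frac)
  have x1: "1 < x1" using f by (simp add: x1_def)
  have m1: "complete_quotient (- x) 1 = 1 + 1 / (x1 - 1)"
  proof -
    have "frac (- x) = 1 - frac x" using assms by (simp add: frac_neg irrational_imp_not_int)
    then have "complete_quotient (- x) 1 = 1 / (1 - frac x)" by simp
    also have "frac x = 1 / x1" by (simp add: x1_def)
    finally show ?thesis using x1 by (simp add: field_simps)
  qed
  have "x1 \<noteq> 2" using irr by auto
  then consider "2 < x1" | "x1 < 2" by linarith
  then show ?thesis
  proof cases
    case 1
    then have "frac (1 + 1 / (x1 - 1)) = 1 / (x1 - 1)" by (simp add: frac_unique_iff)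
    then have "complete_quotient (- x) 2 = x1 - 1" using m1 by (simp add: numeral_2_eq_2)
    then have "complete_quotient (- x) 3 = 1 / frac x1"
      by (simp add: numeral_3_eq_3 numeral_2_eq_2 frac_def)
    moreover have "complete_quotient x 2 = 1 / frac x1"
      by (simp add: numeral_2_eq_2 x1_def)
    ultimately show ?thesis by (intro tails_meet_I[of _ 2 _ 3]) simp_all
  next
    case 2
    then have "frac x1 = x1 - 1" using x1 by (simp add: frac_unique_iff)
    then have x2: "complete_quotient x 2 = 1 / (x1 - 1)" by (simp add: numeral_2_eq_2 x1_def)
    then have "complete_quotient (- x) 1 = complete_quotient x 2 + of_int 1" using m1 by simp
    then have "complete_quotient (- x) 2 = 1 / frac (complete_quotient x 2 + of_int 1)"
      by (simp add: numeral_2_eq_2)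
    also have "\<dots> = complete_quotient x 3"
      by (simp only: frac_add_of_int_right numeral_3_eq_3 numeral_2_eq_2 complete_quotient.simps)
    finally show ?thesis by (intro tails_meet_I[of _ 3 _ 2]) simp_all
  qed
qed

lemma tails_meet_inverse:
  assumes "x \<notin> \<rat>"
  shows "tails_meet (-1) x (1 / x)"
proof -
  have pos: "tails_meet (-1) y (1 / y)" if "y \<notin> \<rat>" "0 < y" for y :: real
  proof (cases "1 < y")
    case False
    moreover have "y \<noteq> 1" using that by auto
    ultimately have "1 < 1 / y" using that by simp
    from tails_meet_inverse_gt_1[OF this] show ?thesis by (simp add: tails_meet_sym)
  qed (rule tails_meet_inverse_gt_1)
  show ?thesis
  proof (cases "0 < x")
    case False
    have "x \<noteq> 0" using assms by auto
    then have "tails_meet (-1) (- x) (1 / (- x))"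
      using False assms by (intro pos) (auto simp: irrational_uminus)
    with tails_meet_uminus[OF assms] have "tails_meet (-1 * -1) x (1 / (- x))"
      by (rule tails_meet_trans)
    from tails_meet_trans[OF this tails_meet_uminus]
    have "tails_meet (-1 * -1 * -1) x (- (1 / (- x)))"
      using irrational_inverse[OF irrational_uminus[OF assms]] .
    then show ?thesis by simp
  qed (simp add: pos assms)
qed

definition moebius :: "int \<Rightarrow> real \<Rightarrow> real \<Rightarrow> bool" where
  "moebius e x y \<longleftrightarrow> (\<exists>a b c d :: int. a * d - b * c = e \<and>
     of_int c * x + of_int d \<noteq> 0 \<and> y = (of_int a * x + of_int b) / (of_int c * x + of_int d))"

lemma irrational_linear_nonzero:
  fixes x :: real
  assumes "x \<notin> \<rat>" and "c \<noteq> 0 \<or> d \<noteq> 0"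
  shows "of_int c * x + of_int d \<noteq> 0"
proof
  assume eq: "of_int c * x + of_int d = 0"
  then have "c \<noteq> 0" using assms(2) by auto
  then have "x = - of_int d / of_int c" using eq by (simp add: field_simps)
  then have "x \<in> \<rat>" by simp
  with assms(1) show False by simp
qed

lemma moebiusI:
  assumes "x \<notin> \<rat>" and "a * d - b * c = e" and "e \<noteq> 0"
    and "y = (of_int a * x + of_int b) / (of_int c * x + of_int d)"
  shows "moebius e x y"
proof -
  have "c \<noteq> 0 \<or> d \<noteq> 0" using assms by auto
  from irrational_linear_nonzero[OF assms(1) this] show ?thesis
    unfolding moebius_def using assms by blast
qed

lemma moebius_trans:
  assumes "moebius e x y" and "moebius e' y z"
  shows "moebius (e * e') x z"
proof -
  obtain a b c d where 1: "a * d - b * c = e" "of_int c * x + of_int d \<noteq> 0"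
    "y = (of_int a * x + of_int b) / (of_int c * x + of_int d)"
    using assms(1) unfolding moebius_def by blast
  obtain a' b' c' d' where 2: "a' * d' - b' * c' = e'" "of_int c' * y + of_int d' \<noteq> 0"
    "z = (of_int a' * y + of_int b') / (of_int c' * y + of_int d')"
    using assms(2) unfolding moebius_def by blast
  define w where "w = of_int c * x + of_int d"
  have w: "w \<noteq> 0" "y * w = of_int a * x + of_int b" using 1 by (auto simp: w_def)
  have den: "of_int (c' * a + d' * c) * x + of_int (c' * b + d' * d) = (of_int c' * y + of_int d') * w"
  proof -
    have "(of_int c' * y + of_int d') * w = of_int c' * (y * w) + of_int d' * w"
      by (simp add: algebra_simps)
    also have "\<dots> = of_int c' * (of_int a * x + of_int b) + of_int d' * (of_int c * x + of_int d)"
      by (simp only: w(2)) (simp add: w_def)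
    finally show ?thesis by (simp add: algebra_simps)
  qed
  have num: "of_int (a' * a + b' * c) * x + of_int (a' * b + b' * d) = (of_int a' * y + of_int b') * w"
  proof -
    have "(of_int a' * y + of_int b') * w = of_int a' * (y * w) + of_int b' * w"
      by (simp add: algebra_simps)
    also have "\<dots> = of_int a' * (of_int a * x + of_int b) + of_int b' * (of_int c * x + of_int d)"
      by (simp only: w(2)) (simp add: w_def)
    finally show ?thesis by (simp add: algebra_simps)
  qed
  have "(a' * a + b' * c) * (c' * b + d' * d) - (a' * b + b' * d) * (c' * a + d' * c) = e * e'"
    unfolding 1(1)[symmetric] 2(1)[symmetric] by (simp add: algebra_simps)
  moreover have "z = (of_int (a' * a + b' * c) * x + of_int (a' * b + b' * d)) /
      (of_int (c' * a + d' * c) * x + of_int (c' * b + d' * d))"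
    unfolding num den using w 2 by simp
  moreover have "of_int (c' * a + d' * c) * x + of_int (c' * b + d' * d) \<noteq> 0"
    unfolding den using w 2 by simp
  ultimately show ?thesis unfolding moebius_def by blast
qed

lemma moebius_sym:
  assumes "moebius e x y" and "e * e = 1"
  shows "moebius e y x"
proof -
  obtain a b c d where 1: "a * d - b * c = e" "of_int c * x + of_int d \<noteq> 0"
    "y = (of_int a * x + of_int b) / (of_int c * x + of_int d)"
    using assms(1) unfolding moebius_def by blast
  define w where "w = of_int c * x + of_int d"
  have w: "w \<noteq> 0" "y * w = of_int a * x + of_int b" using 1 by (auto simp: w_def)
  have e: "real_of_int e = of_int a * of_int d - of_int b * of_int c" "e \<noteq> 0"
    using 1(1) assms(2) by auto
  have den: "(of_int (- c) * y + of_int a) * w = of_int e"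
  proof -
    have "(of_int (- c) * y + of_int a) * w = - of_int c * (y * w) + of_int a * w"
      by (simp add: algebra_simps)
    also have "\<dots> = - of_int c * (of_int a * x + of_int b) + of_int a * (of_int c * x + of_int d)"
      by (simp only: w(2)) (simp add: w_def)
    finally show ?thesis by (simp add: e algebra_simps)
  qed
  have num: "(of_int d * y + of_int (- b)) * w = of_int e * x"
  proof -
    have "(of_int d * y + of_int (- b)) * w = of_int d * (y * w) - of_int b * w"
      by (simp add: algebra_simps)
    also have "\<dots> = of_int d * (of_int a * x + of_int b) - of_int b * (of_int c * x + of_int d)"
      by (simp only: w(2)) (simp add: w_def)
    finally show ?thesis by (simp add: e algebra_simps)
  qed
  have nz: "of_int (- c) * y + of_int a \<noteq> 0" using den e(2) by auto
  have "x = ((of_int d * y + of_int (- b)) * w) / ((of_int (- c) * y + of_int a) * w)"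
    unfolding num den using e(2) by simp
  also have "\<dots> = (of_int d * y + of_int (- b)) / (of_int (- c) * y + of_int a)"
    using w(1) by simp
  finally have "x = \<dots>" .
  moreover have "d * a - (- b) * (- c) = e" using 1(1) by (simp add: mult.commute)
  ultimately show ?thesis unfolding moebius_def using nz by blast
qed

lemma moebius_complete_quotient:
  assumes "x \<notin> \<rat>"
  shows "moebius ((-1) ^ p) x (complete_quotient x p)"
proof (induction p)
  case 0
  show ?case by (rule moebiusI[of _ 1 1 0 0]) (auto simp: assms)
next
  case (Suc p)
  have "moebius (-1) (complete_quotient x p) (complete_quotient x (Suc p))"
    by (rule moebiusI[of _ 0 "- \<lfloor>complete_quotient x p\<rfloor>" 1 1])
      (auto simp: assms complete_quotient_irrational frac_def)
  from moebius_trans[OF Suc this] show ?case by (simp add: mult.commute)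
qed

lemma tails_meet_imp_moebius:
  assumes "x \<notin> \<rat>" and "y \<notin> \<rat>" and "tails_meet e x y"
  shows "moebius e x y"
proof -
  obtain p q where pq: "complete_quotient x p = complete_quotient y q" "(-1) ^ (p + q) = e"
    using assms(3) unfolding tails_meet_def by blast
  have "moebius ((-1) ^ q) (complete_quotient y q) y"
    by (rule moebius_sym[OF moebius_complete_quotient[OF assms(2)]])
      (simp flip: power_add)
  with moebius_complete_quotient[OF assms(1), of p] pq(1)
  have "moebius ((-1) ^ p * (-1) ^ q) x y" by (metis moebius_trans)
  with pq(2) show ?thesis by (simp add: power_add)
qed

lemma moebius_irrational:
  assumes "x \<notin> \<rat>" and "moebius e x y" and "e * e = 1"
  shows "y \<notin> \<rat>"
proof
  assume "y \<in> \<rat>"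
  obtain a b c d where "x = (of_int a * y + of_int b) / (of_int c * y + of_int d)"
    using moebius_sym[OF assms(2,3)] unfolding moebius_def by blast
  with \<open>y \<in> \<rat>\<close> have "x \<in> \<rat>" by simp
  with assms(1) show False by simp
qed

text \<open>Euclid's algorithm on the first column of the matrix factors the transformation into integer
  translations, inversions and sign changes, for each of which the tails are known to meet.\<close>

lemma unimodular_imp_tails_meet:
  fixes x :: real and a b c d e :: int
  assumes "x \<notin> \<rat>" and "a * d - b * c = e" and "e * e = 1"
  shows "tails_meet e x ((of_int a * x + of_int b) / (of_int c * x + of_int d))"
  using assms(2,3)
proof (induction "nat \<bar>c\<bar>" arbitrary: a b c d e rule: less_induct)
  case less
  have e: "e = 1 \<or> e = -1" using less.prems(2) by (simp add: zmult_eq_1_iff)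
  show ?case
  proof (cases "c = 0")
    case True
    then have "a * d = e" using less.prems by simp
    have "d dvd 1" using \<open>a * d = e\<close> less.prems(2) by (metis dvd_mult dvd_triv_right dvd_trans)
    then have d: "d = 1 \<or> d = -1" by (simp add: zdvd1_eq abs_if split: if_splits)
    have y: "(of_int a * x + of_int b) / (of_int c * x + of_int d) = of_int e * x + of_int (b * d)"
      using d True \<open>a * d = e\<close> by auto
    show ?thesis
    proof (cases "e = 1")
      case True
      with tails_meet_add_int[of x "b * d"] show ?thesis unfolding y by simp
    next
      case False
      then have "e = -1" using e by simp
      from tails_meet_trans[OF tails_meet_uminus[OF assms(1)] tails_meet_add_int[of "- x" "b * d"]]
      show ?thesis unfolding y \<open>e = -1\<close> by simp
    qed
  next
    case False
    \<comment> \<open>Split off the integer \<open>q\<close> and invert: what remains is a transformation with the smaller lower left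
      entry \<open>r\<close> and the opposite determinant.\<close>
    define q r where "q = a div c" and "r = a mod c"
    have a: "a = q * c + r" by (simp add: q_def r_def)
    define u v where "u = of_int c * x + of_int d" and "v = of_int r * x + of_int (b - q * d)"
    have det: "c * (b - q * d) - d * r = - e"
      using less.prems(1) by (simp add: a algebra_simps)
    have "u \<noteq> 0" unfolding u_def by (rule irrational_linear_nonzero) (use assms False in auto)
    have "r \<noteq> 0 \<or> b - q * d \<noteq> 0" using det less.prems(2) by auto
    then have "v \<noteq> 0" unfolding v_def by (rule irrational_linear_nonzero[OF assms(1)])
    have "nat \<bar>r\<bar> < nat \<bar>c\<bar>" using False by (simp add: r_def abs_mod_less)
    then have t1: "tails_meet (- e) x (u / v)"
      unfolding u_def v_def by (rule less.hyps) (use det less.prems in auto)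
    have "moebius (- e) x (u / v)"
      unfolding u_def v_def by (rule moebiusI[OF assms(1) det]) (use e in auto)
    then have irr: "u / v \<notin> \<rat>"
      by (rule moebius_irrational[OF assms(1)]) (use less.prems in auto)
    have "tails_meet (- e * -1 * 1) x (1 / (u / v) + of_int q)"
      by (intro tails_meet_trans[OF _ tails_meet_add_int] tails_meet_trans[OF t1] tails_meet_inverse irr)
    moreover have "1 / (u / v) + of_int q = (of_int a * x + of_int b) / u"
      using \<open>u \<noteq> 0\<close> \<open>v \<noteq> 0\<close> by (simp add: field_simps a) (simp add: u_def v_def algebra_simps)
    ultimately show ?thesis by (simp add: u_def)
  qed
qed

theorem serret:
  assumes "x \<notin> \<rat>" and "y \<notin> \<rat>" and "e * e = 1"
  shows "moebius e x y \<longleftrightarrow> tails_meet e x y"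
proof
  assume "moebius e x y"
  then show "tails_meet e x y"
    unfolding moebius_def using unimodular_imp_tails_meet[OF assms(1) _ assms(3)] by blast
qed (rule tails_meet_imp_moebius[OF assms(1,2)])

section \<open>Forms and their roots\<close>

fun disc :: "form \<Rightarrow> int" where
  "disc (m, n, k) = k\<^sup>2 - 4 * m * n"

fun xi_minus :: "form \<Rightarrow> real" where
  "xi_minus (m, n, k) =
     (- real_of_int k - sqrt (real_of_int (k\<^sup>2 - 4 * m * n))) / (2 * real_of_int m)"

definition surd_form :: "form \<Rightarrow> bool" where
  "surd_form f \<longleftrightarrow> 0 < disc f \<and> \<not> is_square (disc f)"

text \<open>The condition \<open>0 < m (x - x')\<close> selects the order of the roots: it says that \<open>m (x - x')\<close> is the
  positive square root of the discriminant, so that \<open>x\<close> is \<open>xi_plus\<close>. Working with this characterisation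
  keeps square roots out of the computations below.\<close>

fun has_roots :: "form \<Rightarrow> real \<Rightarrow> real \<Rightarrow> bool" where
  "has_roots (m, n, k) x x' \<longleftrightarrow> real_of_int k = - of_int m * (x + x') \<and>
     real_of_int n = of_int m * x * x' \<and> 0 < of_int m * (x - x')"

lemma has_roots_disc:
  assumes "has_roots (m, n, k) x x'"
  shows "real_of_int (disc (m, n, k)) = (of_int m * (x - x'))\<^sup>2"
proof -
  have "real_of_int k = - of_int m * (x + x')" "real_of_int n = of_int m * x * x'"
    using assms by auto
  then show ?thesis by (simp add: power2_eq_square) (simp add: algebra_simps)
qed

lemma has_roots_imp_xi:
  assumes "has_roots f x x'"
  shows "xi_plus f = x" and "xi_minus f = x'"
proof -
  obtain m n k where f: "f = (m, n, k)" by (cases f)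
  have r: "real_of_int k = - of_int m * (x + x')" "real_of_int n = of_int m * x * x'"
    "0 < of_int m * (x - x')" using assms by (auto simp: f)
  have "real_of_int (k\<^sup>2 - 4 * m * n) = (of_int m * (x - x'))\<^sup>2"
    using has_roots_disc assms unfolding f by simp
  then have s: "sqrt (real_of_int (k\<^sup>2 - 4 * m * n)) = of_int m * (x - x')"
    using r(3) by (simp only: real_sqrt_abs)
  have "m \<noteq> 0" using r(3) by auto
  then show "xi_plus f = x" "xi_minus f = x'"
    unfolding f xi_plus.simps xi_minus.simps s r(1) by (simp_all add: field_simps)
qed

lemma sqrt_nonsquare_irrational:
  assumes "0 < d" and "\<not> is_square d"
  shows "sqrt (real_of_int d) \<notin> \<rat>"
proof
  assume "sqrt (real_of_int d) \<in> \<rat>"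
  then have "sqrt (real_of_int d) \<in> \<int>"
    by (intro rational_algebraic_int_is_int algebraic_int_sqrt) auto
  then obtain t where t: "sqrt (real_of_int d) = of_int t" by (elim Ints_cases)
  have "real_of_int d = (sqrt (real_of_int d))\<^sup>2" using assms(1) by simp
  then have "real_of_int d = of_int (t\<^sup>2)" unfolding t by simp
  then have "d = t\<^sup>2" by (simp only: of_int_eq_iff)
  with assms(2) show False unfolding is_nth_power_def by blast
qed

lemma surd_form_lead_nonzero: "surd_form (m, n, k) \<Longrightarrow> m \<noteq> 0"
  unfolding surd_form_def by (auto simp: is_nth_power_def)

lemma surd_form_has_roots:
  assumes "surd_form f"
  shows "has_roots f (xi_plus f) (xi_minus f)"
proof -
  obtain m n k where f: "f = (m, n, k)" by (cases f)
  define s where "s = sqrt (real_of_int (k\<^sup>2 - 4 * m * n))"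
  have m: "m \<noteq> 0" using assms surd_form_lead_nonzero by (simp add: f)
  have pos: "0 < k\<^sup>2 - 4 * m * n" using assms by (simp add: surd_form_def f)
  then have "0 < real_of_int (k\<^sup>2 - 4 * m * n)" by (simp only: of_int_0_less_iff)
  then have s: "0 < s" "s * s = real_of_int (k\<^sup>2 - 4 * m * n)" by (auto simp: s_def)
  have ss: "s * s = of_int k * of_int k - 4 * of_int m * of_int n"
    using s(2) by (simp add: power2_eq_square)
  define x x' where "x = xi_plus f" and "x' = xi_minus f"
  have x: "2 * of_int m * x = - of_int k + s" "2 * of_int m * x' = - of_int k - s"
    using m by (simp_all add: x_def x'_def f s_def)
  have "2 * of_int m * (2 * (of_int m * x * x')) = (2 * of_int m * x) * (2 * of_int m * x')"
    by (simp add: algebra_simps)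
  also have "\<dots> = 2 * of_int m * (2 * of_int n)"
    unfolding x using ss by (simp add: algebra_simps)
  finally have "of_int m * x * x' = real_of_int n" using m by simp
  moreover have "real_of_int k = - of_int m * (x + x')" "of_int m * (x - x') = s"
    using x by (simp_all add: algebra_simps)
  ultimately have "has_roots (m, n, k) x x'" using s(1) by simp
  then show ?thesis by (simp only: f[symmetric] x_def x'_def)
qed

lemma xi_irrational:
  assumes "surd_form f"
  shows "xi_plus f \<notin> \<rat>" and "xi_minus f \<notin> \<rat>"
proof -
  obtain m n k where f: "f = (m, n, k)" by (cases f)
  define s where "s = sqrt (real_of_int (k\<^sup>2 - 4 * m * n))"
  have s: "s \<notin> \<rat>"
    unfolding s_def by (rule sqrt_nonsquare_irrational) (use assms in \<open>auto simp: surd_form_def f\<close>)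
  have m: "m \<noteq> 0" using assms surd_form_lead_nonzero by (simp add: f)
  have "s = 2 * of_int m * xi_plus f + of_int k" "s = - (2 * of_int m * xi_minus f + of_int k)"
    using m by (simp_all add: f s_def field_simps)
  then show "xi_plus f \<notin> \<rat>" "xi_minus f \<notin> \<rat>"
    using s by (metis Rats_add Rats_minus_iff Rats_mult Rats_number_of Rats_of_int)+
qed

lemma surd_form_xi_nonzero: "surd_form f \<Longrightarrow> xi_plus f \<noteq> 0 \<and> xi_minus f \<noteq> 0"
  using xi_irrational[of f] by auto


text \<open>An irrational root fixes the quadratic equation up to a factor, and the discriminant together with
  the choice of the root fixes that factor including its sign.\<close>

lemma surd_form_eqI:
  assumes f: "surd_form f" and g: "surd_form g"
    and disc: "disc f = disc g" and xi: "xi_plus f = xi_plus g"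
  shows "f = g"
proof -
  obtain m n k where f_eq: "f = (m, n, k)" by (cases f)
  obtain m' n' k' where g_eq: "g = (m', n', k')" by (cases g)
  define x y y' where "x = xi_plus f" and "y = xi_minus f" and "y' = xi_minus g"
  have rf: "real_of_int k = - of_int m * (x + y)" "real_of_int n = of_int m * x * y"
    "0 < of_int m * (x - y)"
    using surd_form_has_roots[OF f] unfolding x_def y_def by (simp_all add: f_eq)
  have rg: "real_of_int k' = - of_int m' * (x + y')" "real_of_int n' = of_int m' * x * y'"
    "0 < of_int m' * (x - y')"
    using surd_form_has_roots[OF g] unfolding x_def y'_def xi by (simp_all add: g_eq)
  have m: "m \<noteq> 0" "m' \<noteq> 0" using surd_form_lead_nonzero f g by (auto simp: f_eq g_eq)
  \<comment> \<open>Eliminating \<open>x\<^sup>2\<close> from the two equations leaves a linear relation with integer coefficients.\<close>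
  have "of_int (m' * k - m * k') * x + of_int (m' * n - m * n') = 0"
    by (simp add: rf rg algebra_simps)
  then have "m' * k - m * k' = 0"
    using irrational_linear_nonzero[of x "m' * k - m * k'" "m' * n - m * n'"]
      xi_irrational(1)[OF f] unfolding x_def by blast
  then have "real_of_int m' * of_int k = of_int m * of_int k'"
    by (metis eq_iff_diff_eq_0 of_int_mult)
  then have "y = y'" using m by (simp add: rf rg)
  moreover have "of_int m * (x - y) = of_int m' * (x - y')"
  proof -
    have "(of_int m * (x - y))\<^sup>2 = (of_int m' * (x - y'))\<^sup>2"
      using has_roots_disc[OF surd_form_has_roots[OF f, unfolded f_eq]]
        has_roots_disc[OF surd_form_has_roots[OF g, unfolded g_eq]] disc xi
      unfolding x_def y_def y'_def f_eq g_eq by metis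
    then show ?thesis using rf(3) rg(3) by (simp add: power2_eq_iff_nonneg)
  qed
  ultimately have "real_of_int m = of_int m'" using rf(3) by auto
  with \<open>y = y'\<close> have "real_of_int k = of_int k'" "real_of_int n = of_int n'"
    unfolding rf rg by simp_all
  with \<open>real_of_int m = of_int m'\<close> show ?thesis by (simp add: f_eq g_eq)
qed

section \<open>Classes of forms through their roots\<close>

fun subst_form :: "int \<Rightarrow> int \<Rightarrow> int \<Rightarrow> int \<Rightarrow> form \<Rightarrow> form" where
  "subst_form a b c d (m, n, k) =
     (m * a\<^sup>2 + n * c\<^sup>2 + k * a * c, m * b\<^sup>2 + n * d\<^sup>2 + k * b * d,
      2 * m * a * b + 2 * n * c * d + k * (a * d + b * c))"

lemma form_eval_subst_form:
  "form_eval (subst_form a b c d f) x y = form_eval f (a * x + b * y) (c * x + d * y)"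
  by (cases f) (simp add: power2_eq_square algebra_simps)

lemma form_eqI:
  assumes "\<And>x y. form_eval f x y = form_eval g x y"
  shows "f = g"
proof -
  obtain m n k m' n' k' where "f = (m, n, k)" "g = (m', n', k')" by (cases f, cases g)
  with assms[of 1 0] assms[of 0 1] assms[of 1 1] show ?thesis by simp
qed

lemma form_class_iff_subst:
  "g \<in> form_class f \<longleftrightarrow> (\<exists>a b c d. a * d - b * c = 1 \<and> g = subst_form a b c d f)"
proof
  assume "g \<in> form_class f"
  then obtain a b c d where det: "a * d - b * c = 1"
    and "\<And>x y. form_eval g x y = form_eval f (a * x + b * y) (c * x + d * y)"
    unfolding form_class_def by blast
  then have "g = subst_form a b c d f" by (intro form_eqI) (simp add: form_eval_subst_form)
  with det show "\<exists>a b c d. a * d - b * c = 1 \<and> g = subst_form a b c d f" by blast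
next
  assume "\<exists>a b c d. a * d - b * c = 1 \<and> g = subst_form a b c d f"
  then show "g \<in> form_class f"
    unfolding form_class_def using form_eval_subst_form by blast
qed

lemma form_class_refl: "f \<in> form_class f"
  unfolding form_class_def mem_Collect_eq
  by (intro exI[of _ 1] exI[of _ 0]) simp

lemma disc_subst_form: "disc (subst_form a b c d f) = (a * d - b * c)\<^sup>2 * disc f"
  by (cases f) (simp add: power2_eq_square algebra_simps)

lemma xi_plus_subst_form:
  assumes "surd_form f" and "a * d - b * c = 1"
  shows "xi_plus (subst_form a b c d f)
    = (of_int d * xi_plus f + of_int (- b)) / (of_int (- c) * xi_plus f + of_int a)"
proof -
  obtain m n k where f: "f = (m, n, k)" by (cases f)
  define x x' where "x = xi_plus f" and "x' = xi_minus f"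
  have r: "real_of_int k = - of_int m * (x + x')" "real_of_int n = of_int m * x * x'"
    "0 < of_int m * (x - x')"
    using surd_form_has_roots[OF assms(1)] unfolding x_def x'_def by (simp_all add: f)
  have "- c \<noteq> 0 \<or> a \<noteq> 0" using assms(2) by auto
  define p p' q q' where "p = of_int d * x - of_int b" and "p' = of_int d * x' - of_int b"
    and "q = of_int a - of_int c * x" and "q' = of_int a - of_int c * x'"
  have q: "q \<noteq> 0" "q' \<noteq> 0"
    using irrational_linear_nonzero[OF _ \<open>- c \<noteq> 0 \<or> a \<noteq> 0\<close>] xi_irrational[OF assms(1)]
    unfolding q_def q'_def x_def x'_def by force+
  have det: "real_of_int a * of_int d - of_int b * of_int c = 1"
    using assms(2) by (metis of_int_1 of_int_diff of_int_mult)
  have "has_roots (subst_form a b c d f) (p / q) (p' / q')"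
  proof -
    have 1: "real_of_int (m * a\<^sup>2 + n * c\<^sup>2 + k * a * c) = of_int m * q * q'"
      by (simp add: r(1,2) q_def q'_def power2_eq_square algebra_simps)
    have 2: "real_of_int (m * b\<^sup>2 + n * d\<^sup>2 + k * b * d) = of_int m * p * p'"
      by (simp add: r(1,2) p_def p'_def power2_eq_square algebra_simps)
    have 3: "real_of_int (2 * m * a * b + 2 * n * c * d + k * (a * d + b * c)) = - of_int m * (p * q' + p' * q)"
      by (simp add: r(1,2) q_def q'_def p_def p'_def power2_eq_square algebra_simps)
    have "p * q' - p' * q = (of_int a * of_int d - of_int b * of_int c) * (x - x')"
      by (simp add: q_def q'_def p_def p'_def algebra_simps)
    then have 4: "p * q' - p' * q = x - x'" by (simp add: det)
    have "of_int m * q * q' * (p / q - p' / q') = of_int m * (p * q' - p' * q)"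
      using q by (simp add: field_simps)
    then have 5: "0 < of_int m * q * q' * (p / q - p' / q')" using r(3) by (simp only: 4)
    show ?thesis
      unfolding f subst_form.simps has_roots.simps 1 2 3
    proof (intro conjI)
      show "- of_int m * (p * q' + p' * q) = - (of_int m * q * q') * (p / q + p' / q')"
        "of_int m * p * p' = of_int m * q * q' * (p / q) * (p' / q')"
        using q by (simp_all add: field_simps)
    qed (rule 5)
  qed
  from has_roots_imp_xi(1)[OF this] show ?thesis by (simp add: p_def q_def x_def)
qed

text \<open>Substitutions of determinant \<open>1\<close> act on the roots by the inverse matrix and preserve their order.
  Conversely, a transformation of the roots lifts to a substitution, and the resulting form is the right one
  by \<open>surd_form_eqI\<close>.\<close>

lemma form_class_iff_moebius:
  assumes "surd_form f"
  shows "g \<in> form_class f \<longleftrightarrow> disc g = disc f \<and> moebius 1 (xi_plus f) (xi_plus g)"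
proof
  assume "g \<in> form_class f"
  then obtain a b c d where g: "a * d - b * c = 1" "g = subst_form a b c d f"
    unfolding form_class_iff_subst by blast
  have "moebius 1 (xi_plus f) (xi_plus g)"
    unfolding g(2) xi_plus_subst_form[OF assms g(1)]
    by (rule moebiusI[OF xi_irrational(1)[OF assms], where a = d and b = "- b" and c = "- c" and d = a])
      (use g(1) in \<open>auto simp: mult.commute\<close>)
  then show "disc g = disc f \<and> moebius 1 (xi_plus f) (xi_plus g)"
    by (simp add: g disc_subst_form)
next
  assume R: "disc g = disc f \<and> moebius 1 (xi_plus f) (xi_plus g)"
  then obtain a b c d where g: "a * d - b * c = 1"
    "xi_plus g = (of_int a * xi_plus f + of_int b) / (of_int c * xi_plus f + of_int d)"
    unfolding moebius_def by blast
  define h where "h = subst_form d (- b) (- c) a f"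
  have det: "d * a - (- b) * (- c) = 1" using g(1) by (simp add: mult.commute)
  have "disc h = disc f" by (simp add: h_def disc_subst_form det[simplified])
  moreover have "xi_plus h = xi_plus g"
    unfolding h_def xi_plus_subst_form[OF assms det] g(2) by simp
  ultimately have "g = h"
    using assms R by (intro surd_form_eqI) (auto simp: surd_form_def)
  then show "g \<in> form_class f" unfolding form_class_iff_subst h_def using det by blast
qed

lemma form_class_eq:
  assumes "surd_form f" and "g \<in> form_class f"
  shows "form_class g = form_class f"
proof -
  have fg: "disc g = disc f" "moebius 1 (xi_plus f) (xi_plus g)"
    using assms form_class_iff_moebius by blast+
  have g: "surd_form g" using assms(1) fg(1) by (simp add: surd_form_def)
  have "moebius 1 (xi_plus g) y \<longleftrightarrow> moebius 1 (xi_plus f) y" for y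
    using moebius_trans[OF fg(2), of 1 y] moebius_trans[OF moebius_sym[OF fg(2)], of 1 y] by auto
  then show ?thesis
    by (intro set_eqI)
      (simp add: form_class_iff_moebius[OF assms(1)] form_class_iff_moebius[OF g] fg(1))
qed

text \<open>Each of the three involutions is, up to a sign of the form, a substitution that normalises
  \<open>SL(2,\<int>)\<close>; the coefficient matrix is conjugated accordingly.\<close>

lemma form_class_symmetry:
  assumes "\<sigma> \<in> {conjugate_form, adjoint_form, antipodal_form}" and "g \<in> form_class f"
  shows "\<sigma> g \<in> form_class (\<sigma> f)"
proof -
  obtain a b c d where g: "a * d - b * c = 1" "g = subst_form a b c d f"
    using assms(2) unfolding form_class_iff_subst by blast
  obtain m n k where f: "f = (m, n, k)" by (cases f)
  have "conjugate_form g = subst_form a (- b) (- c) d (conjugate_form f)"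
    "adjoint_form g = subst_form d (- c) (- b) a (adjoint_form f)"
    "antipodal_form g = subst_form d c b a (antipodal_form f)"
    by (simp_all add: g(2) f algebra_simps)
  moreover have "a * d - (- b) * (- c) = 1" "d * a - (- c) * (- b) = 1" "d * a - c * b = 1"
    using g(1) by (simp_all add: mult.commute)
  ultimately show ?thesis using assms(1) unfolding form_class_iff_subst by blast
qed

lemma invariant_under_iff:
  assumes \<sigma>: "\<sigma> \<in> {conjugate_form, adjoint_form, antipodal_form}" and "surd_form f"
  shows "invariant_under \<sigma> (form_class f) \<longleftrightarrow> \<sigma> f \<in> form_class f"
proof
  assume "invariant_under \<sigma> (form_class f)"
  then show "\<sigma> f \<in> form_class f"
    unfolding invariant_under_def using form_class_refl by blast
next
  assume "\<sigma> f \<in> form_class f"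
  then have eq: "form_class (\<sigma> f) = form_class f" by (rule form_class_eq[OF assms(2)])
  have closed: "\<sigma> g \<in> form_class f" if "g \<in> form_class f" for g
    using form_class_symmetry[OF \<sigma> that] eq by simp
  have involution: "\<sigma> (\<sigma> g) = g" for g using \<sigma> by (cases g) auto
  have "g \<in> \<sigma> ` form_class f" if "g \<in> form_class f" for g
    using closed[OF that] involution by (metis image_eqI)
  with closed show "invariant_under \<sigma> (form_class f)"
    unfolding invariant_under_def by blast
qed

text \<open>The negative reciprocal of the second root is the root of the adjoint form. For reduced
  forms it is greater than \<open>1\<close>.\<close>

definition dual_root :: "form \<Rightarrow> real" where
  "dual_root f = - 1 / xi_minus f"

lemma xi_plus_symmetric:
  assumes "surd_form f"
  shows "xi_plus (conjugate_form f) = - xi_minus f"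
    and "xi_plus (adjoint_form f) = dual_root f"
    and "xi_plus (antipodal_form f) = 1 / xi_plus f"
proof -
  obtain m n k where f: "f = (m, n, k)" by (cases f)
  define x x' where "x = xi_plus f" and "x' = xi_minus f"
  have r: "real_of_int k = - of_int m * (x + x')" "real_of_int n = of_int m * x * x'"
    "0 < of_int m * (x - x')"
    using surd_form_has_roots[OF assms(1)] unfolding x_def x'_def by (simp_all add: f)
  have nz: "x \<noteq> 0" "x' \<noteq> 0" using surd_form_xi_nonzero[OF assms] by (simp_all add: x_def x'_def)
  have "has_roots (conjugate_form f) (- x') (- x)"
    "has_roots (adjoint_form f) (- 1 / x') (- 1 / x)"
    "has_roots (antipodal_form f) (1 / x) (1 / x')"
  proof -
    have "- (of_int m * x * x') * (- 1 / x' - - 1 / x) = of_int m * (x - x')"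
      "- (of_int m * x * x') * (1 / x - 1 / x') = of_int m * (x - x')"
      "of_int m * (- x' - - x) = of_int m * (x - x')"
      using nz by (simp_all add: field_simps)
    then have pos: "0 < - (of_int m * x * x') * (- 1 / x' - - 1 / x)"
      "0 < - (of_int m * x * x') * (1 / x - 1 / x')" "0 < of_int m * (- x' - - x)"
      using r(3) by simp_all
    show "has_roots (conjugate_form f) (- x') (- x)"
      unfolding f conjugate_form.simps has_roots.simps of_int_minus r(1,2)
      using pos(3) by (simp add: algebra_simps)
    show "has_roots (adjoint_form f) (- 1 / x') (- 1 / x)"
      unfolding f adjoint_form.simps has_roots.simps of_int_minus r(1,2)
      using pos(1) nz by (intro conjI) (simp_all add: field_simps)
    show "has_roots (antipodal_form f) (1 / x) (1 / x')"
      unfolding f antipodal_form.simps has_roots.simps of_int_minus r(1,2)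
      using pos(2) nz by (intro conjI) (simp_all add: field_simps)
  qed
  from this[THEN has_roots_imp_xi(1)]
  show "xi_plus (conjugate_form f) = - xi_minus f"
    "xi_plus (adjoint_form f) = dual_root f"
    "xi_plus (antipodal_form f) = 1 / xi_plus f"
    by (simp_all add: x_def x'_def dual_root_def)
qed

lemma moebius_inverse:
  assumes "x \<notin> \<rat>"
  shows "moebius (-1) x (1 / x)"
  by (rule moebiusI[OF assms, of 0 0 1 1]) auto

lemma dual_root_irrational: "surd_form f \<Longrightarrow> dual_root f \<notin> \<rat>"
  using irrational_uminus[OF irrational_inverse[OF xi_irrational(2)]] by (simp add: dual_root_def)

text \<open>The roots \<open>-\<xi>'\<close> of the conjugate and \<open>1/\<xi>\<close> of the antipodal form are the reciprocals of \<open>-1/\<xi>'\<close> and \<open>\<xi>\<close>,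
  which trades determinant \<open>1\<close> for \<open>-1\<close>.\<close>

lemma symmetric_class_iff_moebius:
  assumes "surd_form f"
  shows "invariant_under conjugate_form (form_class f) \<longleftrightarrow> moebius (-1) (xi_plus f) (dual_root f)"
    and "invariant_under adjoint_form (form_class f) \<longleftrightarrow> moebius 1 (xi_plus f) (dual_root f)"
    and "invariant_under antipodal_form (form_class f) \<longleftrightarrow> moebius (-1) (xi_plus f) (xi_plus f)"
proof -
  have disc: "disc (conjugate_form f) = disc f" "disc (adjoint_form f) = disc f"
    "disc (antipodal_form f) = disc f" by (cases f; simp)+
  have flip: "moebius 1 x (1 / y) \<longleftrightarrow> moebius (-1) x y" if "y \<notin> \<rat>" for x y
    using moebius_trans[OF _ moebius_inverse[OF that], of "-1" x]
      moebius_trans[OF _ moebius_inverse[OF irrational_inverse[OF that]], of 1 x] by auto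
  have "- xi_minus f = 1 / dual_root f" by (simp add: dual_root_def)
  then show "invariant_under conjugate_form (form_class f) \<longleftrightarrow> moebius (-1) (xi_plus f) (dual_root f)"
    using flip[OF dual_root_irrational[OF assms]] assms
    by (simp add: invariant_under_iff form_class_iff_moebius disc xi_plus_symmetric)
  show "invariant_under adjoint_form (form_class f) \<longleftrightarrow> moebius 1 (xi_plus f) (dual_root f)"
    using assms by (simp add: invariant_under_iff form_class_iff_moebius disc xi_plus_symmetric)
  show "invariant_under antipodal_form (form_class f) \<longleftrightarrow> moebius (-1) (xi_plus f) (xi_plus f)"
    using flip[OF xi_irrational(1)[OF assms]] assms
    by (simp add: invariant_under_iff form_class_iff_moebius disc xi_plus_symmetric)
qed

section \<open>The continued fraction as a sequence of forms\<close>

text \<open>The substitution \<open>(x, y) \<mapsto> (a x + y, x)\<close> takes the root \<open>\<xi>\<close> to \<open>1 / (\<xi> - a)\<close>. Its determinant is \<open>-1\<close>, which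
  exchanges the roles of the two roots; changing the sign of the form restores them.\<close>

fun cf_step :: "form \<Rightarrow> form" where
  "cf_step (m, n, k) = (let a = \<lfloor>xi_plus (m, n, k)\<rfloor> in
     (- (m * a\<^sup>2 + k * a + n), - m, - (2 * m * a + k)))"

lemma disc_cf_step: "disc (cf_step f) = disc f"
  by (cases f) (simp add: Let_def power2_eq_square algebra_simps)

lemma xi_cf_step:
  assumes "surd_form f"
  shows "xi_plus (cf_step f) = 1 / frac (xi_plus f)"
    and "xi_minus (cf_step f) = 1 / (xi_minus f - \<lfloor>xi_plus f\<rfloor>)"
proof -
  obtain m n k where f: "f = (m, n, k)" by (cases f)
  define x x' where "x = xi_plus f" and "x' = xi_minus f"
  define a where "a = \<lfloor>x\<rfloor>"
  have r: "real_of_int k = - of_int m * (x + x')" "real_of_int n = of_int m * x * x'"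
    "0 < of_int m * (x - x')"
    using surd_form_has_roots[OF assms(1)] unfolding x_def x'_def by (simp_all add: f)
  define u u' where "u = x - of_int a" and "u' = x' - of_int a"
  have "x \<noteq> of_int a" "x' \<noteq> of_int a"
    using xi_irrational[OF assms] unfolding x_def x'_def by (metis Rats_of_int)+
  then have u: "u \<noteq> 0" "u' \<noteq> 0" by (simp_all add: u_def u'_def)
  have step: "cf_step f = (- (m * a\<^sup>2 + k * a + n), - m, - (2 * m * a + k))"
    unfolding f cf_step.simps Let_def a_def x_def by simp
  have lead: "real_of_int (- (m * a\<^sup>2 + k * a + n)) = - (of_int m * u * u')"
    by (simp add: r(1,2) u_def u'_def power2_eq_square algebra_simps)
  have mixed: "real_of_int (- (2 * m * a + k)) = of_int m * (u + u')"
    by (simp add: r(1,2) u_def u'_def algebra_simps)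
  have "- (of_int m * u * u') * (1 / u - 1 / u') = of_int m * (u - u')"
    using u by (simp add: field_simps)
  then have pos: "0 < - (of_int m * u * u') * (1 / u - 1 / u')"
    using r(3) by (simp only:) (simp add: u_def u'_def)
  have "has_roots (cf_step f) (1 / u) (1 / u')"
    unfolding step has_roots.simps lead mixed
  proof (intro conjI)
    show "of_int m * (u + u') = - (- (of_int m * u * u')) * (1 / u + 1 / u')"
      "real_of_int (- m) = - (of_int m * u * u') * (1 / u) * (1 / u')"
      using u by (simp_all add: field_simps)
  qed (rule pos)
  from has_roots_imp_xi[OF this]
  show "xi_plus (cf_step f) = 1 / frac (xi_plus f)"
    "xi_minus (cf_step f) = 1 / (xi_minus f - \<lfloor>xi_plus f\<rfloor>)"
    by (simp_all add: u_def u'_def x_def x'_def a_def frac_def)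
qed

definition cf_form :: "form \<Rightarrow> nat \<Rightarrow> form" where
  "cf_form f i = (cf_step ^^ i) f"

lemma cf_form_Suc: "cf_form f (Suc i) = cf_step (cf_form f i)"
  by (simp add: cf_form_def)

lemma disc_cf_form: "disc (cf_form f i) = disc f"
  by (induction i) (simp_all add: cf_form_def disc_cf_step)

lemma surd_form_cf_form: "surd_form f \<Longrightarrow> surd_form (cf_form f i)"
  by (simp add: surd_form_def disc_cf_form)

lemma xi_plus_cf_form:
  "surd_form f \<Longrightarrow> xi_plus (cf_form f i) = complete_quotient (xi_plus f) i"
  by (induction i) (simp_all add: cf_form_def xi_cf_step surd_form_cf_form[unfolded cf_form_def])

definition reduced :: "form \<Rightarrow> bool" where
  "reduced f \<longleftrightarrow> 1 < xi_plus f \<and> - 1 < xi_minus f \<and> xi_minus f < 0"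

lemma reduced_cf_step:
  assumes "surd_form f" and "1 < xi_plus f" and "xi_minus f < 0"
  shows "reduced (cf_step f)"
proof -
  have "1 < 1 / frac (xi_plus f)"
    using irrational_frac_pos[OF xi_irrational(1)[OF assms(1)]] frac_lt_1 by simp
  moreover have "xi_minus f - \<lfloor>xi_plus f\<rfloor> < - 1"
  proof -
    have "1 \<le> \<lfloor>xi_plus f\<rfloor>" using assms(2) by simp
    then show ?thesis using assms(3) by linarith
  qed
  ultimately show ?thesis
    unfolding reduced_def xi_cf_step[OF assms(1)] by (simp add: field_simps)
qed

text \<open>If \<open>\<xi>'\<close> never became negative, it would have to follow the expansion of \<open>\<xi>\<close>: if the integer part of
  \<open>\<xi>'\<close> is below that of \<open>\<xi>\<close>, the next second root is negative at once; if it is above, the next second root is below \<open>1\<close>, hence below the next partial quotient, and the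
  one after that is negative. But equal partial quotients force \<open>\<xi>' = \<xi>\<close>.\<close>

lemma eventually_xi_minus_negative:
  assumes "surd_form f"
  obtains i where "0 < i" and "xi_minus (cf_form f i) < 0"
proof (rule ccontr)
  assume "\<not> thesis"
  with that have nonneg: "0 \<le> xi_minus (cf_form f i)" if "0 < i" for i
    using that by (meson not_le)
  let ?x = "\<lambda>i. xi_plus (cf_form f i)" and ?x' = "\<lambda>i. xi_minus (cf_form f i)"
  have step: "?x' (Suc i) = 1 / (?x' i - \<lfloor>?x i\<rfloor>)" for i
    using xi_cf_step(2)[OF surd_form_cf_form[OF assms]] by (simp add: cf_form_Suc)
  have ge: "\<lfloor>?x i\<rfloor> \<le> ?x' i" for i
    using nonneg[of "Suc i"] step[of i] by (simp add: zero_le_divide_1_iff)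
  have floor_eq: "\<lfloor>?x' i\<rfloor> = \<lfloor>?x i\<rfloor>" for i
  proof (rule ccontr)
    assume "\<lfloor>?x' i\<rfloor> \<noteq> \<lfloor>?x i\<rfloor>"
    moreover have "\<lfloor>?x i\<rfloor> \<le> \<lfloor>?x' i\<rfloor>" using ge by (simp add: le_floor_iff)
    ultimately have "\<lfloor>?x i\<rfloor> + 1 \<le> \<lfloor>?x' i\<rfloor>" by linarith
    then have "1 \<le> ?x' i - \<lfloor>?x i\<rfloor>" by linarith
    then have "?x' (Suc i) \<le> 1" unfolding step by simp
    moreover have "1 < ?x (Suc i)"
      using complete_quotient_gt_1[OF xi_irrational(1)[OF assms]]
      by (simp add: xi_plus_cf_form assms del: complete_quotient.simps)
    then have "1 \<le> \<lfloor>?x (Suc i)\<rfloor>" by simp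
    then have "1 \<le> real_of_int \<lfloor>?x (Suc i)\<rfloor>" by linarith
    ultimately have "?x' (Suc i) = 1" using ge[of "Suc i"] by linarith
    then show False using xi_irrational(2)[OF surd_form_cf_form[OF assms], of "Suc i"] by simp
  qed
  have "?x' i = complete_quotient (xi_minus f) i" for i
  proof (induction i)
    case (Suc i)
    have "?x' (Suc i) = 1 / frac (?x' i)" by (simp add: step floor_eq frac_def)
    with Suc show ?case by simp
  qed (simp add: cf_form_def)
  then have "partial_quotient (xi_minus f) i = partial_quotient (xi_plus f) i" for i
    using floor_eq[of i] by (simp add: partial_quotient_def xi_plus_cf_form assms)
  then have "xi_minus f = xi_plus f"
    using xi_irrational[OF assms] by (intro partial_quotients_inj) auto
  moreover have "xi_minus f \<noteq> xi_plus f"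
    using surd_form_has_roots[OF assms] by (cases f) auto
  ultimately show False by simp
qed

lemma eventually_reduced:
  assumes "surd_form f"
  obtains I where "\<forall>i\<ge>I. reduced (cf_form f i)"
proof -
  obtain I where I: "0 < I" "xi_minus (cf_form f I) < 0"
    using eventually_xi_minus_negative[OF assms] .
  have gt: "1 < xi_plus (cf_form f i)" if "0 < i" for i
    using complete_quotient_gt_1[OF xi_irrational(1)[OF assms] that] by (simp add: xi_plus_cf_form assms)
  have "reduced (cf_form f i)" if "Suc I \<le> i" for i
    using that
  proof (induction i rule: dec_induct)
    case base
    show ?case
      using reduced_cf_step[OF surd_form_cf_form[OF assms] gt[OF I(1)] I(2)] by (simp add: cf_form_Suc)
  next
    case (step i)
    then show ?case
      using reduced_cf_step[OF surd_form_cf_form[OF assms]] by (auto simp: reduced_def cf_form_Suc)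
  qed
  with that show ?thesis by blast
qed

text \<open>The roots of a reduced form have opposite signs, so \<open>m n < 0\<close> and the discriminant
  \<open>k\<^sup>2 + 4 \<bar>m n\<bar>\<close> bounds all coefficients.\<close>

lemma finite_reduced_forms: "finite {f. surd_form f \<and> reduced f \<and> disc f = D}"
proof (rule finite_subset)
  show "finite ({- D..D} \<times> {- D..D} \<times> {- D..D})" by simp
  show "{f. surd_form f \<and> reduced f \<and> disc f = D} \<subseteq> {- D..D} \<times> {- D..D} \<times> {- D..D}"
  proof
    fix f assume "f \<in> {f. surd_form f \<and> reduced f \<and> disc f = D}"
    then have f: "surd_form f" "reduced f" "disc f = D" by auto
    obtain m n k where eq: "f = (m, n, k)" by (cases f)
    have "real_of_int n = of_int m * xi_plus f * xi_minus f"
      using surd_form_has_roots[OF f(1)] by (simp add: eq)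
    then have "real_of_int (m * n) = (of_int m)\<^sup>2 * (xi_plus f * xi_minus f)"
      by (simp add: power2_eq_square)
    also have "\<dots> < 0"
    proof (rule mult_pos_neg)
      show "0 < (real_of_int m)\<^sup>2" using surd_form_lead_nonzero f(1) by (simp add: eq)
      show "xi_plus f * xi_minus f < 0" using f(2) by (simp add: reduced_def mult_pos_neg)
    qed
    finally have mn: "m * n < 0" by (simp only: of_int_less_0_iff)
    have D: "D = k\<^sup>2 - 4 * (m * n)" using f(3) by (simp add: eq)
    have "0 \<le> k\<^sup>2" by simp
    have "\<bar>m\<bar> * 1 \<le> \<bar>m\<bar> * \<bar>n\<bar>" "1 * \<bar>n\<bar> \<le> \<bar>m\<bar> * \<bar>n\<bar>"
    proof -
      have "m \<noteq> 0" "n \<noteq> 0" using mn by auto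
      then have "1 \<le> \<bar>m\<bar>" "1 \<le> \<bar>n\<bar>" by linarith+
      then show "\<bar>m\<bar> * 1 \<le> \<bar>m\<bar> * \<bar>n\<bar>" "1 * \<bar>n\<bar> \<le> \<bar>m\<bar> * \<bar>n\<bar>"
        by (intro mult_mono; simp)+
    qed
    moreover have "\<bar>m\<bar> * \<bar>n\<bar> = - (m * n)" using mn by (simp flip: abs_mult)
    ultimately have "\<bar>m\<bar> \<le> D" "\<bar>n\<bar> \<le> D" using D mn \<open>0 \<le> k\<^sup>2\<close> by linarith+
    moreover have "\<bar>k\<bar> \<le> k\<^sup>2"
      using self_le_power[of "\<bar>k\<bar>" 2] by (cases "k = 0") auto
    then have "\<bar>k\<bar> \<le> D" using D mn by linarith
    ultimately show "f \<in> {- D..D} \<times> {- D..D} \<times> {- D..D}" by (auto simp: eq)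
  qed
qed

theorem lagrange:
  assumes "surd_form f"
  obtains w where "repeating_block (partial_quotient (xi_plus f)) w"
proof -
  obtain I where red: "\<forall>i\<ge>I. reduced (cf_form f i)"
    using eventually_reduced[OF assms] .
  have "(\<lambda>i. cf_form f (I + i)) ` UNIV \<subseteq> {g. surd_form g \<and> reduced g \<and> disc g = disc f}"
    using red by (auto simp: surd_form_cf_form assms disc_cf_form)
  then have "finite ((\<lambda>i. cf_form f (I + i)) ` UNIV)"
    using finite_reduced_forms finite_subset by blast
  then have "\<not> inj (\<lambda>i. cf_form f (I + i))"
    using finite_imageD infinite_UNIV_nat by blast
  then obtain p q where pq: "p < q" "cf_form f (I + p) = cf_form f (I + q)"
    unfolding inj_def by (metis linorder_neqE_nat)
  define N r where "N = I + p" and "r = q - p"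
  have r: "0 < r" "N + r = I + q" using pq(1) by (auto simp: N_def r_def)
  have per: "partial_quotient (xi_plus f) (N + r + i) = partial_quotient (xi_plus f) (N + i)" for i
    using pq(2) unfolding partial_quotient_add xi_plus_cf_form[OF assms, symmetric] r(2) by (simp add: N_def)
  define w where "w = map (\<lambda>i. partial_quotient (xi_plus f) (N + i)) [0..<r]"
  have "partial_quotient (xi_plus f) (N + i) = w ! (i mod r)" for i
  proof (induction i rule: less_induct)
    case (less i)
    show ?case
    proof (cases "i < r")
      case False
      then have "i - r < i" "N + i = N + r + (i - r)" using r(1) by auto
      then show ?thesis using less[of "i - r"] per[of "i - r"] False by (simp add: le_mod_geq)
    qed (simp add: w_def)
  qed
  then have "repeating_block (partial_quotient (xi_plus f)) w"
    unfolding repeating_block_def using r(1) by (auto simp: w_def)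
  with that show ?thesis .
qed

section \<open>The dual root reads the continued fraction backwards\<close>

lemma dual_root_gt_1: "reduced f \<Longrightarrow> 1 < dual_root f"
  by (auto simp: reduced_def dual_root_def field_simps)

lemma dual_root_cf_step:
  assumes "surd_form f"
  shows "dual_root (cf_step f) = of_int \<lfloor>xi_plus f\<rfloor> + 1 / dual_root f"
  by (simp add: dual_root_def xi_cf_step[OF assms])

text \<open>The recursion \<open>z\<^sub>i\<^sub>+\<^sub>1 = a\<^sub>i + 1 / z\<^sub>i\<close> with \<open>z\<^sub>i > 1\<close> is a continued fraction step read from right to
  left: the partial quotient of \<open>z\<^sub>i\<^sub>+\<^sub>1\<close> is \<open>a\<^sub>i\<close> and its next complete quotient is \<open>z\<^sub>i\<close>.\<close>

lemma complete_quotient_dual_root: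
  assumes "surd_form f" and "\<And>i. reduced (cf_form f i)"
  shows "complete_quotient (dual_root (cf_form f (i + j))) j = dual_root (cf_form f i)"
proof (induction j)
  case (Suc j)
  let ?z = "dual_root (cf_form f (i + j))"
  have "1 < ?z" using assms dual_root_gt_1 by blast
  then have "frac (1 / ?z) = 1 / ?z" by (simp add: frac_eq)
  moreover have "dual_root (cf_form f (i + Suc j)) = of_int \<lfloor>xi_plus (cf_form f (i + j))\<rfloor> + 1 / ?z"
    using dual_root_cf_step[OF surd_form_cf_form[OF assms(1)]] by (simp add: cf_form_Suc)
  ultimately have "complete_quotient (dual_root (cf_form f (i + Suc j))) 1 = ?z" by simp
  with Suc complete_quotient_add[of _ 1 j] show ?case by simp
qed simp

lemma partial_quotient_dual_root:
  assumes "surd_form f" and "\<And>i. reduced (cf_form f i)"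
  shows "partial_quotient (dual_root (cf_form f (Suc i + j))) j = partial_quotient (xi_plus f) i"
proof -
  have "1 < dual_root (cf_form f i)" using assms dual_root_gt_1 by blast
  then have "\<lfloor>1 / dual_root (cf_form f i)\<rfloor> = 0" by (simp add: floor_eq_iff)
  then have "\<lfloor>dual_root (cf_form f (Suc i))\<rfloor> = \<lfloor>xi_plus (cf_form f i)\<rfloor>"
    using dual_root_cf_step[OF surd_form_cf_form[OF assms(1)]] by (simp add: cf_form_Suc)
  then show ?thesis
    unfolding partial_quotient_def complete_quotient_dual_root[OF assms]
    by (simp add: xi_plus_cf_form assms)
qed

lemma moebius_dual_root_cf_form:
  assumes "surd_form f"
  shows "moebius ((-1) ^ i) (dual_root f) (dual_root (cf_form f i))"
proof (induction i)
  case 0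
  show ?case
    by (rule moebiusI[OF dual_root_irrational[OF assms], of 1 1 0 0]) (auto simp: cf_form_def)
next
  case (Suc i)
  let ?g = "cf_form f i"
  have irr: "dual_root ?g \<notin> \<rat>" using assms by (simp add: dual_root_irrational surd_form_cf_form)
  then have "dual_root ?g \<noteq> 0" by auto
  then have "moebius (-1) (dual_root ?g) (dual_root (cf_step ?g))"
    by (intro moebiusI[OF irr, of "\<lfloor>xi_plus ?g\<rfloor>" 0 1 1])
      (simp_all add: dual_root_cf_step surd_form_cf_form assms field_simps)
  from moebius_trans[OF Suc this] show ?case by (simp add: cf_form_Suc mult.commute)
qed

text \<open>Passing from \<open>f\<close> to its \<open>i\<close>-th form transforms \<open>\<xi>\<close> and \<open>-1/\<xi>'\<close> with the same determinant
  \<open>(-1)\<^sup>i\<close>, which enters twice and cancels.\<close>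

lemma moebius_cf_form_iff:
  assumes "surd_form f" and "e * e = 1"
  shows "moebius e (xi_plus f) (dual_root f)
      \<longleftrightarrow> moebius e (xi_plus (cf_form f i)) (dual_root (cf_form f i))"
    and "moebius e (xi_plus f) (xi_plus f)
      \<longleftrightarrow> moebius e (xi_plus (cf_form f i)) (xi_plus (cf_form f i))"
proof -
  let ?s = "(-1) ^ i :: int"
  have s: "?s * ?s = 1" "?s * e * ?s = e" by (simp_all flip: power_add add: mult.commute mult.left_commute)
  have transfer: "moebius e x y \<longleftrightarrow> moebius e u v"
    if "moebius ?s x u" "moebius ?s y v" for x y u v
  proof
    assume "moebius e x y"
    from moebius_trans[OF moebius_trans[OF moebius_sym[OF that(1) s(1)] this] that(2)]
    show "moebius e u v" by (simp add: s)
  next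
    assume "moebius e u v"
    from moebius_trans[OF moebius_trans[OF that(1) this] moebius_sym[OF that(2) s(1)]]
    show "moebius e x y" by (simp add: s)
  qed
  have xi: "moebius ?s (xi_plus f) (xi_plus (cf_form f i))"
    using moebius_complete_quotient[OF xi_irrational(1)[OF assms(1)]] by (simp add: xi_plus_cf_form assms)
  show "moebius e (xi_plus f) (dual_root f)
      \<longleftrightarrow> moebius e (xi_plus (cf_form f i)) (dual_root (cf_form f i))"
    by (rule transfer[OF xi moebius_dual_root_cf_form[OF assms(1)]])
  show "moebius e (xi_plus f) (xi_plus f)
      \<longleftrightarrow> moebius e (xi_plus (cf_form f i)) (xi_plus (cf_form f i))"
    by (rule transfer[OF xi xi])
qed

section \<open>Reflections of periodic sequences\<close>

definition has_period :: "(int \<Rightarrow> 'a) \<Rightarrow> nat \<Rightarrow> bool" where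
  "has_period A r \<longleftrightarrow> 0 < r \<and> (\<forall>i. A (i + int r) = A i)"

definition minimal_period :: "(int \<Rightarrow> 'a) \<Rightarrow> nat \<Rightarrow> bool" where
  "minimal_period A r \<longleftrightarrow> has_period A r \<and> (\<forall>d. has_period A d \<longrightarrow> r \<le> d)"

definition reflects :: "(int \<Rightarrow> 'a) \<Rightarrow> int \<Rightarrow> bool" where
  "reflects A c \<longleftrightarrow> (\<forall>i. A (c - i) = A i)"

definition window :: "(int \<Rightarrow> 'a) \<Rightarrow> nat \<Rightarrow> int \<Rightarrow> 'a list" where
  "window A l c = map (\<lambda>j. A (c + int j)) [0..<l]"

lemma length_window [simp]: "length (window A l c) = l"
  by (simp add: window_def)

lemma nth_window [simp]: "j < l \<Longrightarrow> window A l c ! j = A (c + int j)"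
  by (simp add: window_def)

lemma window_append: "window A (l + l') c = window A l c @ window A l' (c + int l)"
  by (rule nth_equalityI) (auto simp: nth_append algebra_simps of_nat_diff)

lemma has_period_multiple:
  assumes "has_period A r"
  shows "A (i + k * int r) = A i"
proof (induction k rule: int_induct[where k = 0])
  case (step1 k)
  have "A (i + (k + 1) * int r) = A ((i + k * int r) + int r)" by (simp add: algebra_simps)
  with step1 assms show ?case by (simp add: has_period_def)
next
  case (step2 k)
  have "A (i + k * int r) = A ((i + (k - 1) * int r) + int r)" by (simp add: algebra_simps)
  with step2 assms show ?case by (simp add: has_period_def)
qed simp

lemma has_period_cong:
  assumes "has_period A r" and "int r dvd i - j"
  shows "A i = A j"
proof -
  obtain k where "i - j = int r * k" using assms(2) by blast
  then have "i = j + k * int r" by (simp add: algebra_simps)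
  then show ?thesis using has_period_multiple[OF assms(1)] by simp
qed

lemma periodic_window_induct:
  assumes "0 < r" and "\<And>j. j < r \<Longrightarrow> P (c + int j)"
    and "\<And>i k. P i \<Longrightarrow> P (i + k * int r)"
  shows "P i"
proof -
  define j where "j = nat ((i - c) mod int r)"
  have j: "int j = (i - c) mod int r" "j < r"
    using assms(1) by (simp_all add: j_def nat_less_iff)
  have "i = (c + int j) + ((i - c) div int r) * int r"
    unfolding j(1) by (simp add: minus_div_mult_eq_mod[symmetric])
  with assms(3)[OF assms(2)[OF j(2)]] show ?thesis by metis
qed

lemma reflects_if_window:
  assumes "has_period A r" and "\<And>j. j < r \<Longrightarrow> A (s - (c + int j)) = A (c + int j)"
  shows "reflects A s"
  unfolding reflects_def
proof
  fix i
  show "A (s - i) = A i"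
  proof (rule periodic_window_induct[where r = r and c = c and i = i])
    show "0 < r" using assms(1) by (simp add: has_period_def)
    show "A (s - (i + k * int r)) = A (i + k * int r)" if "A (s - i) = A i" for i k
      using that has_period_multiple[OF assms(1), of i k] has_period_multiple[OF assms(1), of "s - i" "- k"]
      by (simp add: algebra_simps)
  qed (rule assms(2))
qed

lemma minimal_period_dvd:
  assumes "minimal_period A r" and "\<And>i. A (i + d) = A i"
  shows "int r dvd d"
proof (rule ccontr)
  assume "\<not> int r dvd d"
  have r: "has_period A r" "0 < r" using assms(1) by (auto simp: minimal_period_def has_period_def)
  define e where "e = nat (d mod int r)"
  have e: "int e = d mod int r" "e < r" using r(2) by (simp_all add: e_def nat_less_iff)
  have "d mod int r \<noteq> 0" using \<open>\<not> int r dvd d\<close> by (simp add: dvd_eq_mod_eq_0)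
  then have "0 < e" using e(1) by linarith
  moreover have "A (i + int e) = A i" for i
  proof -
    have "A (i + int e) = A (i + d)"
      by (rule has_period_cong[OF r(1)]) (simp add: e(1) mod_eq_dvd_iff[symmetric])
    then show ?thesis using assms(2) by simp
  qed
  ultimately have "r \<le> e" using assms(1) by (simp add: minimal_period_def has_period_def)
  with e(2) show False by simp
qed

lemma palindromic_window_iff:
  "rev (window A l c) = window A l c \<longleftrightarrow> (\<forall>j<l. A (2 * c + int l - 1 - (c + int j)) = A (c + int j))"
proof -
  have "rev (window A l c) ! j = A (2 * c + int l - 1 - (c + int j))" if "j < l" for j
    using that by (simp add: rev_nth of_nat_diff algebra_simps)
  then show ?thesis by (auto simp: list_eq_iff_nth_eq)
qed

text \<open>A palindrome of length \<open>r\<close> that starts at \<open>c\<close> is the reflection \<open>i \<mapsto> 2 c + r - 1 - i\<close>, whose constant is odd for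
  even \<open>r\<close>.\<close>

lemma palindromic_rotation_iff:
  assumes "has_period A r" and "even r"
  shows "(\<exists>c. rev (window A r c) = window A r c) \<longleftrightarrow> (\<exists>s. odd s \<and> reflects A s)"
proof
  assume "\<exists>c. rev (window A r c) = window A r c"
  then obtain c where "\<forall>j<r. A (2 * c + int r - 1 - (c + int j)) = A (c + int j)"
    by (auto simp: palindromic_window_iff)
  then have "reflects A (2 * c + int r - 1)" by (intro reflects_if_window[OF assms(1)]) blast
  moreover have "odd (2 * c + int r - 1)" using assms(2) by simp
  ultimately show "\<exists>s. odd s \<and> reflects A s" by blast
next
  assume "\<exists>s. odd s \<and> reflects A s"
  then obtain s where s: "odd s" "reflects A s" by blast
  then have "even (s + 1 - int r)" using assms(2) by simp
  then obtain c where "s + 1 - int r = 2 * c" by blast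
  then have "s = 2 * c + int r - 1" by simp
  with s(2) have "rev (window A r c) = window A r c"
    unfolding palindromic_window_iff reflects_def by blast
  then show "\<exists>c. rev (window A r c) = window A r c" by blast
qed

text \<open>If palindromes of lengths \<open>l\<close> and \<open>l'\<close> with \<open>l + l' = r\<close> follow each other from \<open>c\<close> on, their reflections have the
  constants \<open>2 c + l - 1\<close> and \<open>2 (c + l) + l' - 1\<close>. These differ by \<open>r\<close>, so both are restrictions
  of one reflection of the periodic sequence, with an even constant for odd \<open>l\<close>. Conversely, a reflection about the
  entry at \<open>c\<close> splits the period from \<open>c\<close> on into this entry and a palindrome of length \<open>r - 1\<close>.\<close>

lemma bipalindromic_rotation_iff:
  assumes "has_period A r" and "even r"
  shows "(\<exists>u v. u @ v \<in> range (window A r) \<and> odd (length u) \<and> rev u = u \<and> odd (length v) \<and> rev v = v)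
    \<longleftrightarrow> (\<exists>s. even s \<and> reflects A s)"
proof
  assume "\<exists>u v. u @ v \<in> range (window A r) \<and> odd (length u) \<and> rev u = u \<and> odd (length v) \<and> rev v = v"
  then obtain u v c where uv: "u @ v = window A r c" "odd (length u)" "rev u = u" "rev v = v" by blast
  define l l' where "l = length u" and "l' = length v"
  have r: "r = l + l'" using arg_cong[OF uv(1), of length] by (simp add: l_def l'_def)
  have "u = window A l c" "v = window A l' (c + int l)"
    using uv(1) unfolding r window_append by (auto simp: l_def l'_def append_eq_append_conv)
  then have pal: "\<forall>j<l. A (2 * c + int l - 1 - (c + int j)) = A (c + int j)"
    "\<forall>j<l'. A (2 * (c + int l) + int l' - 1 - (c + int l + int j)) = A (c + int l + int j)"
    using uv(3,4) palindromic_window_iff by metis+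
  define s where "s = 2 * c + int l - 1"
  have "A (s - (c + int j)) = A (c + int j)" if "j < r" for j
  proof (cases "j < l")
    case False
    define i where "i = j - l"
    have i: "i < l'" "int j = int l + int i" using False that r by (auto simp: i_def)
    have "A (s - (c + int j)) = A (2 * (c + int l) + int l' - 1 - (c + int l + int i))"
      by (rule has_period_cong[OF assms(1)], rule dvdI[of _ _ "-1"]) (simp add: s_def i(2) r)
    then show ?thesis using pal(2) i by (simp add: add.assoc)
  qed (use pal(1) in \<open>simp add: s_def\<close>)
  then have "reflects A s" by (rule reflects_if_window[OF assms(1)])
  moreover have "even s" using uv(2) by (simp add: s_def l_def)
  ultimately show "\<exists>s. even s \<and> reflects A s" by blast
next
  assume "\<exists>s. even s \<and> reflects A s"
  then obtain c where c: "reflects A (2 * c)" by auto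
  obtain l where r: "r = 1 + l" using assms(1) by (metis Suc_eq_plus1_left gr0_implies_Suc has_period_def)
  have "A (2 * (c + 1) + int l - 1 - (c + 1 + int j)) = A (c + 1 + int j)" for j
  proof -
    have "A (2 * (c + 1) + int l - 1 - (c + 1 + int j)) = A (2 * c - (c + 1 + int j))"
      by (rule has_period_cong[OF assms(1)]) (simp add: r add.commute)
    also have "\<dots> = A (c + 1 + int j)" using c unfolding reflects_def by blast
    finally show ?thesis .
  qed
  then have "rev (window A l (c + 1)) = window A l (c + 1)" by (simp add: palindromic_window_iff)
  moreover have "rev (window A 1 c) = window A 1 c" by (simp add: window_def)
  moreover have "window A 1 c @ window A l (c + 1) \<in> range (window A r)"
    unfolding r window_append by simp
  moreover have "odd (length (window A l (c + 1)))" using assms(2) by (simp add: r)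
  ultimately show "\<exists>u v. u @ v \<in> range (window A r) \<and> odd (length u) \<and> rev u = u \<and> odd (length v) \<and> rev v = v"
    by (intro exI[of _ "window A 1 c"] exI[of _ "window A l (c + 1)"]) simp
qed

section \<open>Repeating blocks of eventually periodic sequences\<close>

lemma repeating_block_tail:
  "repeating_block (\<lambda>i. s (p + i)) w \<longleftrightarrow> repeating_block s w"
proof
  assume "repeating_block (\<lambda>i. s (p + i)) w"
  then show "repeating_block s w"
    unfolding repeating_block_def by (metis add.assoc)
next
  assume "repeating_block s w"
  then obtain N where w: "w \<noteq> []" "\<And>i. s (N + i) = w ! (i mod length w)"
    unfolding repeating_block_def by blast
  have "p \<le> N + p * length w" using w(1) by (cases w) auto
  then have "p + (N + p * length w - p + i) = N + (p * length w + i)" for i by simp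
  then have "s (p + (N + p * length w - p + i)) = w ! (i mod length w)" for i
    using w(2)[of "p * length w + i"] by (metis mod_mult_self3)
  with w(1) show "repeating_block (\<lambda>i. s (p + i)) w"
    unfolding repeating_block_def by blast
qed

lemma minimal_repeating_block_tail_cong:
  assumes "\<And>i. s (p + i) = t (q + i)"
  shows "minimal_repeating_block s w \<longleftrightarrow> minimal_repeating_block t w"
proof -
  have "repeating_block s v \<longleftrightarrow> repeating_block t v" for v
    using repeating_block_tail[of s p v] repeating_block_tail[of t q v] assms by simp
  then show ?thesis by (simp add: minimal_repeating_block_def)
qed

lemma repeating_block_window:
  assumes "has_period A r" and "\<And>i. s (N + i) = A (int i)"
  shows "repeating_block s (window A r c)"
proof -
  have r: "0 < r" using assms(1) by (simp add: has_period_def)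
  have "s (N + nat (c mod int r) + i) = window A r c ! (i mod length (window A r c))" for i
  proof -
    have "s (N + nat (c mod int r) + i) = A (c mod int r + int i)"
      using assms(2)[of "nat (c mod int r) + i"] r by (simp add: add.assoc)
    also have "\<dots> = A (c + int (i mod r))"
      by (rule has_period_cong[OF assms(1)])
        (simp add: mod_eq_dvd_iff[symmetric] zmod_int mod_simps)
    finally show ?thesis using r by simp
  qed
  moreover have "window A r c \<noteq> []" using r by (metis length_window length_greater_0_conv)
  ultimately show ?thesis unfolding repeating_block_def by blast
qed

text \<open>Beyond both starting indices the block and \<open>A\<close> describe the same terms of \<open>s\<close>; the period \<open>r\<close> carries
  what is seen there to all of \<open>A\<close>.\<close>

lemma repeating_block_has_period:
  assumes "has_period A r" and s: "\<And>i. s (N + i) = A (int i)" and "repeating_block s w"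
  shows "has_period A (length w)" and "w \<in> range (window A (length w))"
proof -
  obtain M where w: "w \<noteq> []" "\<And>i. s (M + i) = w ! (i mod length w)"
    using assms(3) unfolding repeating_block_def by blast
  have A: "A (int M + int i) = w ! ((N + i) mod length w)" for i
    using s[of "M + i"] w(2)[of "N + i"] by (simp add: add.left_commute)
  have r: "0 < r" using assms(1) by (simp add: has_period_def)
  show per: "has_period A (length w)"
    unfolding has_period_def
  proof (intro conjI allI)
    fix i
    show "A (i + int (length w)) = A i"
    proof (rule periodic_window_induct[OF r, where c = "int M" and i = i])
      show "A (int M + int j + int (length w)) = A (int M + int j)" for j
      proof -
        have "A (int M + int (j + length w)) = A (int M + int j)"
          unfolding A by (simp flip: add.assoc)
        then show ?thesis by (simp add: add.assoc)
      qed
      show "A (i + k * int r + int (length w)) = A (i + k * int r)"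
        if "A (i + int (length w)) = A i" for i k
        using that has_period_multiple[OF assms(1), of i k]
          has_period_multiple[OF assms(1), of "i + int (length w)" k] by (simp add: algebra_simps)
    qed
  qed (use w(1) in simp)
  have "w = window A (length w) (int M - int N)"
  proof (rule nth_equalityI)
    fix j assume j: "j < length w"
    have "N \<le> N * length w + j" using w(1) by (cases w) auto
    define t where "t = N * length w + j - N"
    have t: "N + t = j + N * length w" "int t = int N * int (length w) + int j - int N"
      using \<open>N \<le> N * length w + j\<close> by (simp_all add: t_def of_nat_diff)
    have "w ! j = A (int M + int t)" unfolding A t(1) using j by simp
    also have "\<dots> = A (int M - int N + int j)"
      by (rule has_period_cong[OF per]) (simp add: t(2))
    finally show "w ! j = window A (length w) (int M - int N) ! j" using j by simp
  qed simp
  then show "w \<in> range (window A (length w))" by blast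
qed

text \<open>Every repeating block has a period of \<open>A\<close> as its length, so the minimal ones are the windows of length \<open>r\<close>, that is,
  the cyclic permutations of one of them.\<close>

lemma minimal_repeating_blocks_eq:
  assumes min: "minimal_period A r" and s: "\<And>i. s (N + i) = A (int i)"
  shows "{w. minimal_repeating_block s w} = range (window A r)"
proof -
  have r: "has_period A r" using min by (simp add: minimal_period_def)
  have long: "r \<le> length v" if "repeating_block s v" for v
    using repeating_block_has_period(1)[OF r s that] min by (simp add: minimal_period_def)
  have block: "repeating_block s (window A r c)" for c
    by (rule repeating_block_window[OF r s])
  show ?thesis
  proof (intro equalityI subsetI)
    fix w assume "w \<in> {w. minimal_repeating_block s w}"
    then have w: "repeating_block s w" "length w \<le> length (window A r 0)"
      using block unfolding minimal_repeating_block_def by blast+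
    then have "length w = r" using long[OF w(1)] by simp
    then show "w \<in> range (window A r)" using repeating_block_has_period(2)[OF r s w(1)] by simp
  next
    fix w assume "w \<in> range (window A r)"
    then show "w \<in> {w. minimal_repeating_block s w}"
      using block long by (auto simp: minimal_repeating_block_def)
  qed
qed

text \<open>The bound \<open>I \<le> N\<close> makes it possible to start the periodic part late enough for other properties of the
  tail, such as reducedness, to hold.\<close>

lemma repeating_block_imp_minimal_period:
  assumes "repeating_block s w"
  obtains A r N where "minimal_period A r" and "I \<le> N" and "\<forall>i. s (N + i) = A (int i)"
proof -
  define v where "v = (ARG_MIN length v. repeating_block s v)"
  have v: "repeating_block s v" "\<And>u. repeating_block s u \<Longrightarrow> length v \<le> length u"
    using arg_min_nat_lemma[of "repeating_block s" w length] assms unfolding v_def by auto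
  obtain M where M: "v \<noteq> []" "\<And>i. s (M + i) = v ! (i mod length v)"
    using v(1) unfolding repeating_block_def by blast
  define A where "A i = v ! nat (i mod int (length v))" for i
  define N where "N = M + I * length v"
  have "I \<le> N" using M(1) by (cases v) (auto simp: N_def)
  have s: "s (N + i) = A (int i)" for i
    using M(2)[of "I * length v + i"] by (simp add: N_def A_def add.assoc nat_mod_distrib)
  have "has_period A (length v)" using M(1) by (simp add: has_period_def A_def)
  moreover have "length v \<le> d" if "has_period A d" for d
    using v(2)[OF repeating_block_window[OF that s]] by simp
  ultimately have "minimal_period A (length v)" by (simp add: minimal_period_def)
  with \<open>I \<le> N\<close> s that show ?thesis by blast
qed

section \<open>Symmetries of the period\<close>

lemma complete_quotients_meet_iff:
  assumes "x \<notin> \<rat>" and "y \<notin> \<rat>"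
  shows "complete_quotient x p = complete_quotient y q
    \<longleftrightarrow> (\<forall>j. partial_quotient x (p + j) = partial_quotient y (q + j))"
  using partial_quotients_inj[of "complete_quotient x p" "complete_quotient y q"] assms
  by (auto simp: partial_quotient_add complete_quotient_irrational)

text \<open>The expansions of \<open>\<bar>\<xi>\<bar>\<close> and \<open>\<xi>\<close> have a common tail, and the period depends only on tails.\<close>

lemma Gamma_eq:
  assumes "surd_form f"
  shows "Gamma f = {w. minimal_repeating_block (partial_quotient (xi_plus f)) w}"
proof -
  have irr: "xi_plus f \<notin> \<rat>" "\<bar>xi_plus f\<bar> \<notin> \<rat>"
    using xi_irrational(1)[OF assms] by (auto simp: abs_if irrational_uminus)
  have "\<exists>e. tails_meet e \<bar>xi_plus f\<bar> (xi_plus f)"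
  proof (cases "xi_plus f < 0")
    case True
    then show ?thesis using tails_meet_sym[OF tails_meet_uminus[OF irr(1)]] by auto
  next
    case False
    then show ?thesis using tails_meet_add_int[of "xi_plus f" 0] by auto
  qed
  then obtain p q where "\<forall>j. partial_quotient \<bar>xi_plus f\<bar> (p + j) = partial_quotient (xi_plus f) (q + j)"
    unfolding tails_meet_def complete_quotients_meet_iff[OF irr(2,1)] by blast
  then show ?thesis
    unfolding Gamma_def cf_elements_def using minimal_repeating_block_tail_cong by blast
qed

text \<open>Take a form \<open>g\<close> in the purely periodic part of the expansion. For its root \<open>x\<close>, with
  partial quotients \<open>A 0, A 1, \<dots>\<close>, and its dual root \<open>z\<close>, with
  partial quotients \<open>A (-1), A (-2), \<dots>\<close>, the \<open>p\<close>-th complete quotient of \<open>x\<close> equals the \<open>q\<close>-th one of \<open>z\<close>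
  iff \<open>A\<close> is symmetric under \<open>i \<mapsto> p - 1 - q - i\<close>. The shift by \<open>1\<close> is the reason why determinant \<open>1\<close>,
  that is \<open>p + q\<close> even, corresponds to an odd reflection constant.\<close>

lemma surd_period:
  assumes "surd_form f"
  obtains A r where "minimal_period A r" and "Gamma f = range (window A r)"
    and "moebius 1 (xi_plus f) (dual_root f) \<longleftrightarrow> (\<exists>s. odd s \<and> reflects A s)"
    and "moebius (-1) (xi_plus f) (dual_root f) \<longleftrightarrow> (\<exists>s. even s \<and> reflects A s)"
    and "moebius (-1) (xi_plus f) (xi_plus f) \<longleftrightarrow> odd r"
proof -
  obtain w where w: "repeating_block (partial_quotient (xi_plus f)) w" using lagrange[OF assms] .
  obtain I where I: "\<forall>i\<ge>I. reduced (cf_form f i)" using eventually_reduced[OF assms] .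
  obtain A r N where min: "minimal_period A r" and "I \<le> N"
    and N: "\<forall>i. partial_quotient (xi_plus f) (N + i) = A (int i)"
    using repeating_block_imp_minimal_period[OF w] .
  have per: "has_period A r" "0 < r" using min by (auto simp: minimal_period_def has_period_def)
  define g where "g = cf_form f N"
  have g: "surd_form g" using assms by (simp add: g_def surd_form_cf_form)
  have shift: "cf_form g i = cf_form f (N + i)" for i
    by (simp add: g_def cf_form_def add.commute[of N] funpow_add)
  have red: "reduced (cf_form g i)" for i using I \<open>I \<le> N\<close> by (simp add: shift)
  define x z where "x = xi_plus g" and "z = dual_root g"
  have irr: "x \<notin> \<rat>" "z \<notin> \<rat>"
    using xi_irrational(1)[OF g] dual_root_irrational[OF g] by (simp_all add: x_def z_def)
  have digit: "partial_quotient x j = A (int j)" for j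
    using N by (simp add: x_def g_def xi_plus_cf_form assms flip: partial_quotient_add)
  have period: "complete_quotient x (p + r) = complete_quotient x p" for p
    unfolding complete_quotients_meet_iff[OF irr(1) irr(1)] digit
    using has_period_multiple[OF per(1), of "int (p + _)" 1] by (simp add: add_ac)
  \<comment> \<open>The period \<open>r\<close> of the partial quotients is also a period of the forms, hence of the dual roots.\<close>
  have return: "cf_form g (t * r) = g" for t
  proof (rule surd_form_eqI)
    have "complete_quotient x (t * r) = x"
      by (induction t) (simp_all add: period add.commute[of r])
    then show "xi_plus (cf_form g (t * r)) = xi_plus g" by (simp add: xi_plus_cf_form g x_def)
  qed (simp_all add: g surd_form_cf_form disc_cf_form)
  have dual_digit: "partial_quotient z j = A (- 1 - int j)" for j
  proof -
    \<comment> \<open>Going around the period \<open>j + 1\<close> times leaves room for \<open>j + 1\<close> steps backwards.\<close>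
    define i where "i = Suc j * r - Suc j"
    have "Suc j \<le> Suc j * r" using per(2) mult_le_mono2[of 1 r "Suc j"] by simp
    then have i: "Suc i + j = Suc j * r" "int i = - 1 - int j + int (Suc j) * int r"
      by (simp_all add: i_def of_nat_diff algebra_simps)
    have "partial_quotient z j = partial_quotient (dual_root (cf_form g (Suc i + j))) j"
      unfolding i(1) return z_def ..
    also have "\<dots> = A (int i)"
      using partial_quotient_dual_root[OF g red] digit by (simp add: x_def)
    also have "\<dots> = A (- 1 - int j)" unfolding i(2) by (rule has_period_multiple[OF per(1)])
    finally show ?thesis .
  qed
  have meet: "complete_quotient x p = complete_quotient z q \<longleftrightarrow> reflects A (int p - 1 - int q)" for p q
  proof
    assume "complete_quotient x p = complete_quotient z q"
    then have "A (int p + int j) = A (- 1 - int q - int j)" for j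
      unfolding complete_quotients_meet_iff[OF irr] digit dual_digit by (simp add: algebra_simps)
    then show "reflects A (int p - 1 - int q)"
      by (intro reflects_if_window[OF per(1), where c = "int p"]) (simp add: algebra_simps)
  next
    assume "reflects A (int p - 1 - int q)"
    then have "A (int p - 1 - int q - (int p + int j)) = A (int p + int j)" for j
      unfolding reflects_def by blast
    then show "complete_quotient x p = complete_quotient z q"
      unfolding complete_quotients_meet_iff[OF irr] digit dual_digit by (simp add: algebra_simps)
  qed
  have reflection: "moebius e x z \<longleftrightarrow> (\<exists>s. (odd s \<longleftrightarrow> e = 1) \<and> reflects A s)"
    if e: "e = 1 \<or> e = -1" for e
  proof -
    have parity: "(-1) ^ (p + q) = e \<longleftrightarrow> (odd (int p - 1 - int q) \<longleftrightarrow> e = 1)" for p q :: nat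
      using e by (cases "even (p + q)") auto
    have "moebius e x z \<longleftrightarrow> (\<exists>p q. reflects A (int p - 1 - int q) \<and> (odd (int p - 1 - int q) \<longleftrightarrow> e = 1))"
      using e by (subst serret[OF irr]) (auto simp: tails_meet_def meet parity)
    also have "\<dots> \<longleftrightarrow> (\<exists>s. (odd s \<longleftrightarrow> e = 1) \<and> reflects A s)"
    proof
      assume "\<exists>s. (odd s \<longleftrightarrow> e = 1) \<and> reflects A s"
      then obtain s where s: "odd s \<longleftrightarrow> e = 1" "reflects A s" by blast
      \<comment> \<open>Every integer is \<open>p - 1 - q\<close> for suitable indices \<open>p\<close> and \<open>q\<close>.\<close>
      have "s = int (nat (s + 1)) - 1 - int (nat (- s - 1))" by simp
      with s show "\<exists>p q. reflects A (int p - 1 - int q) \<and> (odd (int p - 1 - int q) \<longleftrightarrow> e = 1)" by metis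
    qed blast
    finally show ?thesis .
  qed
  have "moebius (-1) x x \<longleftrightarrow> odd r"
  proof
    assume "moebius (-1) x x"
    then have "tails_meet (-1) x x" using serret[OF irr(1) irr(1)] by simp
    then obtain p q where pq: "complete_quotient x p = complete_quotient x q" "(-1) ^ (p + q) = (-1 :: int)"
      unfolding tails_meet_def by blast
    have odd: "odd (int q - int p)" using pq(2) by (cases "even (p + q)") auto
    have A: "A (int q + int j) = A (int p + int j)" for j
      using pq(1) unfolding complete_quotients_meet_iff[OF irr(1) irr(1)] digit by simp
    have "A (i + (int q - int p)) = A i" for i
    proof (rule periodic_window_induct[OF per(2), where c = "int p" and i = i])
      show "A (int p + int j + (int q - int p)) = A (int p + int j)" for j
        using A[of j] by (simp add: algebra_simps)
      show "A (i + k * int r + (int q - int p)) = A (i + k * int r)"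
        if "A (i + (int q - int p)) = A i" for i k
        using that has_period_multiple[OF per(1), of i k]
          has_period_multiple[OF per(1), of "i + (int q - int p)" k] by (simp add: algebra_simps)
    qed
    then have "int r dvd int q - int p" by (rule minimal_period_dvd[OF min])
    with odd show "odd r" by (meson dvd_trans even_of_nat)
  next
    assume "odd r"
    then have "tails_meet (-1) x x"
      using period[of 0] by (intro tails_meet_I[of x r x 0]) simp_all
    then show "moebius (-1) x x" using serret[OF irr(1) irr(1)] by simp
  qed
  moreover have "Gamma f = range (window A r)"
    unfolding Gamma_eq[OF assms] using N by (intro minimal_repeating_blocks_eq[OF min, of _ N]) simp
  ultimately show ?thesis
    using that[OF min] reflection[of 1] reflection[of "-1"]
      moebius_cf_form_iff[OF assms, of 1 N] moebius_cf_form_iff[OF assms, of "-1" N]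
    by (simp add: x_def z_def g_def)
qed

theorem theorem3p9:
  fixes m n k :: int
  assumes "k\<^sup>2 - 4 * m * n > 0"
    and "\<not> is_square (k\<^sup>2 - 4 * m * n)"
  shows "(even_period (Gamma (m, n, k)) \<and>
          \<not> palindromic_period (Gamma (m, n, k)) \<and>
          \<not> bipalindromic_period (Gamma (m, n, k)))
    \<longleftrightarrow> asymmetric (form_class (m, n, k))"
proof -
  let ?f = "(m, n, k)"
  have f: "surd_form ?f" using assms by (simp add: surd_form_def)
  obtain A r where min: "minimal_period A r" and Gamma: "Gamma ?f = range (window A r)"
    and adjoint: "moebius 1 (xi_plus ?f) (dual_root ?f) \<longleftrightarrow> (\<exists>s. odd s \<and> reflects A s)"
    and conjugate: "moebius (-1) (xi_plus ?f) (dual_root ?f) \<longleftrightarrow> (\<exists>s. even s \<and> reflects A s)"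
    and antipodal: "moebius (-1) (xi_plus ?f) (xi_plus ?f) \<longleftrightarrow> odd r"
    using surd_period[OF f] .
  have per: "has_period A r" using min by (simp add: minimal_period_def)
  have even: "even_period (Gamma ?f) \<longleftrightarrow> even r"
    unfolding even_period_def Gamma by auto
  have "palindromic_period (Gamma ?f) \<longleftrightarrow> (\<exists>s. odd s \<and> reflects A s)"
    "bipalindromic_period (Gamma ?f) \<longleftrightarrow> (\<exists>s. even s \<and> reflects A s)" if "even r"
    unfolding palindromic_period_def bipalindromic_period_def Gamma
    using palindromic_rotation_iff[OF per that] bipalindromic_rotation_iff[OF per that] by auto
  then show ?thesis
    unfolding asymmetric_def symmetric_class_iff_moebius[OF f] adjoint conjugate antipodal even
    by blast
qed

end
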